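(* For $n\ge 3$, suppose that $r=r(n)\ge 3$ is an integer, and let $\boldsymbol{k}=\boldsymbol{k}(n)=(k_1,\ldots,k_n)$ be a sequence of non-negative integers with maximum entry $k_{\max}$ and sum $M(\boldsymbol{k})=\sum_{i=1}^n k_i$. Assume that $r$ divides $M(\boldsymbol{k})$ for infinitely many values of $n$, and let $n\to\infty$ along these values. Let $X=X(n)$ be a given simple $r$-uniform hypergraph on the vertex set $V=\{v_1,\ldots,v_n\}$ with degree sequence $\boldsymbol{x}$ and with $t=t(n)$ edges. Define \[ \rho=\frac{t\,k_{\max}^3}{M(\boldsymbol{k})^2}+\frac{r\,t\,k_{\max}^4}{M(\boldsymbol{k})^3} \] and suppose that $r^4k_{\max}^3=o(M(\boldsymbol{k}))$ and $\rho=o(1)$. Then the probability that a uniformly random hypergraph from $\mathcal{H}_r(\boldsymbol{k})$ contains no edge of $X$ is $\exp(O(\rho))$. Therefore, the number $|\mathcal{H}_r(\boldsymbol{k},X)|$ of simple $r$-uniform hypergraphs on $V$ with degree sequence $\boldsymbol{k}$ containing no edge of $X$ is \[ |\mathcal{H}_r(\boldsymbol{k},X)|=\frac{M(\boldsymbol{k})!}{(M(\boldsymbol{k})/r)!\;r!^{\,M(\boldsymbol{k})/r}\,\prod_{i=1}^n k_i!}\,\exp\left(\frac{-(r-1)M_2(\boldsymbol{k})}{2M(\boldsymbol{k})}+O\left(\frac{r^4k_{\max}^3}{M(\boldsymbol{k})}+\rho\right)\right). \]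
   Context: A hypergraph on the vertex set $V=\{v_1,\ldots,v_n\}$ is a pair $(V,E)$ where $E$ is a multiset of multisubsets of $V$, called edges. It is simple if it has no loops (no vertex has multiplicity greater than one in an edge) and no repeated edges; it is $r$-uniform if every edge contains exactly $r$ vertices (counting multiplicity). Thus a simple $r$-uniform hypergraph is a set of $r$-element subsets of $V$. The degree sequence lists the degree of $v_1,\ldots,v_n$ in order. $\mathcal{H}_r(\boldsymbol{k})$ is the set of all simple $r$-uniform hypergraphs on $V$ with degree sequence $\boldsymbol{k}$, and $\mathcal{H}_r(\boldsymbol{k},X)$ is the set of those hypergraphs in $\mathcal{H}_r(\boldsymbol{k})$ which contain no edge of $X$. Notation: $(a)_b=a(a-1)\cdots(a-b+1)$ and $M_2(\boldsymbol{k})=\sum_{i=1}^n (k_i)_2$. All asymptotics are as $n\to\infty$ along values of $n$ for which $r$ divides $M(\boldsymbol{k})$. *)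

theory Defs
  imports "HOL-Probability.Probability" "HOL-Library.Landau_Symbols"
begin

text \<open>The vertex \<open>v\<^sub>i\<close> is represented by its index \<open>i\<close>, so the vertex set is \<open>{1..n}\<close>.
  A simple \<open>r\<close>-uniform hypergraph is given by its set of edges, each an \<open>r\<close>-element set of
  vertices: no loops means that edges are sets, no repeated edges that they form a set.\<close>

definition simple_uniform_hypergraph :: "nat \<Rightarrow> 'a set \<Rightarrow> 'a set set \<Rightarrow> bool" where
  "simple_uniform_hypergraph r V E \<longleftrightarrow> (\<forall>e\<in>E. e \<subseteq> V \<and> card e = r)"

definition hdegree :: "'a set set \<Rightarrow> 'a \<Rightarrow> nat" where
  "hdegree E v = card {e \<in> E. v \<in> e}"

text \<open>A degree sequence \<open>(k\<^sub>1, \<dots>, k\<^sub>n)\<close> is a function whose values outside \<open>{1..n}\<close> are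
  irrelevant.\<close>

definition has_degree_sequence :: "nat \<Rightarrow> nat set set \<Rightarrow> (nat \<Rightarrow> nat) \<Rightarrow> bool" where
  "has_degree_sequence n E k \<longleftrightarrow> (\<forall>i\<in>{1..n}. hdegree E i = k i)"

definition hypergraphs :: "nat \<Rightarrow> nat \<Rightarrow> (nat \<Rightarrow> nat) \<Rightarrow> nat set set set" where
  "hypergraphs r n k = {E. simple_uniform_hypergraph r {1..n} E \<and> has_degree_sequence n E k}"

definition hypergraphs_avoiding ::
    "nat \<Rightarrow> nat \<Rightarrow> (nat \<Rightarrow> nat) \<Rightarrow> nat set set \<Rightarrow> nat set set set" where
  "hypergraphs_avoiding r n k X = {E \<in> hypergraphs r n k. E \<inter> X = {}}"

text \<open>The truncated subtraction is harmless: if \<open>b > a\<close>, the product contains the factor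
  \<open>a - a = 0\<close>.\<close>

definition falling :: "nat \<Rightarrow> nat \<Rightarrow> nat" where
  "falling a b = (\<Prod>j<b. a - j)"

definition kmax :: "nat \<Rightarrow> (nat \<Rightarrow> nat) \<Rightarrow> nat" where
  "kmax n k = Max (k ` {1..n})"

definition M :: "nat \<Rightarrow> (nat \<Rightarrow> nat) \<Rightarrow> nat" where
  "M n k = (\<Sum>i=1..n. k i)"

definition M2 :: "nat \<Rightarrow> (nat \<Rightarrow> nat) \<Rightarrow> nat" where
  "M2 n k = (\<Sum>i=1..n. falling (k i) 2)"

definition rho :: "nat \<Rightarrow> nat \<Rightarrow> (nat \<Rightarrow> nat) \<Rightarrow> nat \<Rightarrow> real" where
  "rho r n k t = real t * real (kmax n k) ^ 3 / real (M n k) ^ 2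
               + real r * real t * real (kmax n k) ^ 4 / real (M n k) ^ 3"

definition admissible :: "(nat \<Rightarrow> nat) \<Rightarrow> (nat \<Rightarrow> nat \<Rightarrow> nat) \<Rightarrow> nat set" where
  "admissible r k = {n. n \<ge> 3 \<and> r n dvd M n (k n)}"

text \<open>The filter for \<open>n \<rightarrow> \<infinity>\<close> along the elements of \<open>N\<close>; it is proper iff \<open>N\<close> is infinite.\<close>

definition along :: "nat set \<Rightarrow> nat filter" where
  "along N = inf sequentially (principal N)"

end

theory Submission
  imports Defs "HOL-Combinatorics.Permutations"
begin

text \<open>
  Give every vertex \<open>v\<^sub>i\<close> a cell of \<open>k\<^sub>i\<close> points and match the \<open>M\<close> points with \<open>M\<close> slots, which are
  grouped into parts of size \<open>r\<close>. Every simple hypergraph with degree sequence \<open>k\<close> arises from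
  \<open>(M/r)! r!\<^sup>M\<^sup>/\<^sup>r \<Prod>k\<^sub>i!\<close> matchings, so the task is to count the matchings without loops and
  repeated edges. Let \<open>K\<close> be the maximum degree. Forbid the \<open>M\<^sub>2/2\<close> pairs of points in a common
  cell one at a time from lying in a common part. Exchanging one point of the pair with a random point shows that each new restriction
  keeps a proportion \<open>1 - (r-1)/M + O(K r\<^sup>2/M\<^sup>2)\<close> of the matchings, and the product of these
  proportions is \<open>exp(-(r-1)M\<^sub>2/2M + O(K\<^sup>2 r\<^sup>2/M))\<close>. Since \<open>r \<ge> 3\<close>, a repeated edge forces three pairs of
  cellmates into two common parts, which has conditional probability at most
  \<open>(MK)\<^sup>3(2r/M)\<^sup>4 = O(r\<^sup>4K\<^sup>3/M)\<close> by the same exchange. Finally, hypergraphs containing a fixed edge \<open>e\<close>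
  inject into those whose degrees on \<open>e\<close> are lowered by one; the ratio of the two counts is
  \<open>O(K\<^sup>3/M\<^sup>2)\<close>, and a union bound over the edges of \<open>X\<close> finishes the proof.
\<close>

section \<open>Switchings in the configuration model\<close>

text \<open>Points and slots are the same set \<open>P\<close>: a permutation \<open>\<sigma>\<close> of \<open>P\<close> matches the point \<open>p\<close>, which lies in
  \<open>cell p\<close>, with the slot \<open>\<sigma> p\<close>, which lies in \<open>part (\<sigma> p)\<close>. The order on \<open>P\<close> only serves to list each
  unordered pair of cellmates once.\<close>

locale configuration_model =
  fixes P :: "'p :: linorder set" and cell :: "'p \<Rightarrow> 'v" and part :: "'p \<Rightarrow> 'j" and r K :: nat
  assumes finite_P: "finite P"
    and card_part: "p \<in> P \<Longrightarrow> card {q \<in> P. part q = part p} = r"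
    and card_cell: "p \<in> P \<Longrightarrow> card {q \<in> P. cell q = cell p} \<le> K"
    and r_ge_3: "r \<ge> 3" and K_pos: "K \<ge> 1"
begin

definition together :: "('p \<Rightarrow> 'p) \<Rightarrow> 'p \<Rightarrow> 'p \<Rightarrow> bool" where
  "together \<sigma> x y \<longleftrightarrow> part (\<sigma> x) = part (\<sigma> y)"

definition mates :: "('p \<times> 'p) set" where
  "mates = {(x, y). x \<in> P \<and> y \<in> P \<and> x \<noteq> y \<and> cell x = cell y}"

text \<open>Quotients of these cardinalities play the role of conditional probabilities: enlarging
  \<open>F\<close> or \<open>G\<close> by a pair conditions on one more separation or one more
  coincidence.\<close>

definition cfgs :: "('p \<times> 'p) set \<Rightarrow> ('p \<times> 'p) set \<Rightarrow> ('p \<Rightarrow> 'p) set" where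
  "cfgs F G = {\<sigma>. \<sigma> permutes P \<and> (\<forall>(x, y)\<in>F. \<not> together \<sigma> x y) \<and> (\<forall>(x, y)\<in>G. together \<sigma> x y)}"

definition swap :: "'p \<Rightarrow> 'p \<Rightarrow> ('p \<Rightarrow> 'p) \<Rightarrow> 'p \<Rightarrow> 'p" where
  "swap x d \<sigma> = \<sigma> \<circ> Transposition.transpose x d"

lemma swap_simps [simp]:
  "swap x d \<sigma> x = \<sigma> d" "swap x d \<sigma> d = \<sigma> x"
  "z \<noteq> x \<Longrightarrow> z \<noteq> d \<Longrightarrow> swap x d \<sigma> z = \<sigma> z"
  by (simp_all add: swap_def)

lemma swap_swap [simp]: "swap x d (swap x d \<sigma>) = \<sigma>"
  by (simp add: swap_def comp_assoc)

lemma swap_permutes: "\<sigma> permutes P \<Longrightarrow> x \<in> P \<Longrightarrow> d \<in> P \<Longrightarrow> swap x d \<sigma> permutes P"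
  unfolding swap_def by (intro permutes_compose permutes_swap_id)

lemma finite_cfgs [simp]: "finite (cfgs F G)"
  unfolding cfgs_def by (rule finite_subset[OF _ finite_permutations[OF finite_P]]) auto

lemma card_block: 
  assumes "\<sigma> permutes P" "x \<in> P"
  shows "card {d \<in> P. together \<sigma> x d} = r"
proof -
  have "bij_betw \<sigma> {d \<in> P. together \<sigma> x d} {q \<in> P. part q = part (\<sigma> x)}"
  proof (rule bij_betwI')
    fix a b assume "a \<in> {d \<in> P. together \<sigma> x d}" "b \<in> {d \<in> P. together \<sigma> x d}"
    show "(\<sigma> a = \<sigma> b) = (a = b)" using permutes_inj[OF assms(1)] by (auto dest: injD)
  next
    fix a assume "a \<in> {d \<in> P. together \<sigma> x d}"
    then show "\<sigma> a \<in> {q \<in> P. part q = part (\<sigma> x)}"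
      using permutes_in_image[OF assms(1)] by (auto simp: together_def)
  next
    fix q assume q: "q \<in> {q \<in> P. part q = part (\<sigma> x)}"
    then have "q \<in> \<sigma> ` P" using permutes_image[OF assms(1)] by simp
    with q show "\<exists>a\<in>{d \<in> P. together \<sigma> x d}. q = \<sigma> a" by (auto simp: together_def)
  qed
  then have "card {d \<in> P. together \<sigma> x d} = card {q \<in> P. part q = part (\<sigma> x)}"
    by (rule bij_betw_same_card)
  also have "\<dots> = r" using card_part assms permutes_in_image[OF assms(1)] by blast
  finally show ?thesis .
qed

lemma card_block_minus:
  assumes "\<sigma> permutes P" "x \<in> P"
  shows "card {d \<in> P. together \<sigma> x d \<and> d \<noteq> x} = r - 1"
proof -
  have "{d \<in> P. together \<sigma> x d \<and> d \<noteq> x} = {d \<in> P. together \<sigma> x d} - {x}" by auto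
  moreover have "x \<in> {d \<in> P. together \<sigma> x d}" using assms by (simp add: together_def)
  ultimately show ?thesis using card_block[OF assms] finite_P by (simp add: card_Diff_singleton)
qed

text \<open>An exchange affects only pairs with exactly one member among \<open>x\<close> and
  \<open>d\<close>: afterwards \<open>x\<close> shares a part with \<open>e\<close> precisely when
  \<open>d\<close> did before, and conversely. \<open>x_ok\<close> and \<open>d_ok\<close> exclude
  new violations of this kind, and forced pairs survive because neither point occurs in
  them.\<close>

lemma swap_in_cfgs:
  assumes \<sigma>: "\<sigma> \<in> cfgs F G" and F: "F \<subseteq> mates" and xd: "x \<in> P" "d \<in> P"
    and G: "\<And>u v. (u, v) \<in> G \<Longrightarrow> x \<notin> {u, v} \<and> d \<notin> {u, v}"
    and x_ok: "\<And>e. \<lbrakk>e \<in> P; e \<noteq> x; e \<noteq> d; cell e = cell x; (x, e) \<in> F \<or> (e, x) \<in> F\<rbrakk> \<Longrightarrow> \<not> together \<sigma> d e"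
    and d_ok: "\<And>e. \<lbrakk>e \<in> P; e \<noteq> d; e \<noteq> x; cell e = cell d; (d, e) \<in> F \<or> (e, d) \<in> F\<rbrakk> \<Longrightarrow> \<not> together \<sigma> x e"
  shows "swap x d \<sigma> \<in> cfgs F G"
proof -
  have perm: "\<sigma> permutes P" and avoid: "\<And>u v. (u, v) \<in> F \<Longrightarrow> \<not> together \<sigma> u v"
    and force: "\<And>u v. (u, v) \<in> G \<Longrightarrow> together \<sigma> u v" using \<sigma> by (auto simp: cfgs_def)
  have "\<not> together (swap x d \<sigma>) u v" if uv: "(u, v) \<in> F" for u v
  proof -
    have m: "u \<in> P" "v \<in> P" "u \<noteq> v" "cell u = cell v" using uv F by (auto simp: mates_def)
    consider "{u, v} = {x, d}" | "u = x" "v \<noteq> d" | "v = x" "u \<noteq> d" | "u = d" "v \<noteq> x" | "v = d" "u \<noteq> x" 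
      | "u \<notin> {x, d}" "v \<notin> {x, d}" by blast
    then show ?thesis
    proof cases
      case 1 then show ?thesis using avoid[OF uv] m by (auto simp: together_def doubleton_eq_iff)
    next
      case 2 then show ?thesis using x_ok[of v] m uv by (auto simp: together_def)
    next
      case 3 then show ?thesis using x_ok[of u] m uv by (auto simp: together_def)
    next
      case 4 then show ?thesis using d_ok[of v] m uv by (auto simp: together_def)
    next
      case 5 then show ?thesis using d_ok[of u] m uv by (auto simp: together_def)
    next
      case 6 then show ?thesis using avoid[OF uv] by (auto simp: together_def)
    qed
  qed
  moreover have "together (swap x d \<sigma>) u v" if uv: "(u, v) \<in> G" for u v
    using G[OF uv] force[OF uv] by (auto simp: together_def)
  ultimately show ?thesis using swap_permutes[OF perm xd] by (auto simp: cfgs_def)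
qed

text \<open>An exchange of \<open>x\<close> with \<open>d\<close> may fail because \<open>d\<close>
  lies in the part of a cellmate of \<open>x\<close>, because a cellmate of \<open>d\<close> lies in
  the part of \<open>x\<close>, or because \<open>d\<close> occurs in a forced pair. Each of the
  first two families has at most \<open>K * r\<close> members. The choice \<open>e = x\<close> in
  the first also excludes every \<open>d\<close> in the part of \<open>x\<close> itself.\<close>

lemma card_bad_swaps:
  assumes perm: "\<sigma> permutes P" and x: "x \<in> P" and G: "finite G"
  shows "card ({d. \<exists>e\<in>P. cell e = cell x \<and> d \<in> P \<and> together \<sigma> e d} \<union> 
      {d. \<exists>e\<in>P. together \<sigma> x e \<and> d \<in> P \<and> cell d = cell e} \<union> fst ` G \<union> snd ` G) \<le> 2 * K * r + 2 * card G"
proof -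
  let ?A = "{e \<in> P. cell e = cell x}" and ?B = "{e \<in> P. together \<sigma> x e}"
  have 1: "card {d. \<exists>e\<in>P. cell e = cell x \<and> d \<in> P \<and> together \<sigma> e d} \<le> K * r"
  proof -
    have "{d. \<exists>e\<in>P. cell e = cell x \<and> d \<in> P \<and> together \<sigma> e d} = (\<Union>e\<in>?A. {d \<in> P. together \<sigma> e d})" by auto
    also have "card \<dots> \<le> (\<Sum>e\<in>?A. card {d \<in> P. together \<sigma> e d})"
      using finite_P by (intro card_UN_le) auto
    also have "\<dots> = card ?A * r" using card_block[OF perm] by simp
    also have "\<dots> \<le> K * r" using card_cell[OF x] by simp
    finally show ?thesis .
  qed
  have 2: "card {d. \<exists>e\<in>P. together \<sigma> x e \<and> d \<in> P \<and> cell d = cell e} \<le> K * r"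
  proof -
    have "{d. \<exists>e\<in>P. together \<sigma> x e \<and> d \<in> P \<and> cell d = cell e} = (\<Union>e\<in>?B. {d \<in> P. cell d = cell e})" by auto
    also have "card \<dots> \<le> (\<Sum>e\<in>?B. card {d \<in> P. cell d = cell e})"
      using finite_P by (intro card_UN_le) auto
    also have "\<dots> \<le> (\<Sum>e\<in>?B. K)" using card_cell by (intro sum_mono) auto
    also have "\<dots> = K * r" using card_block[OF perm x] by simp
    finally show ?thesis .
  qed
  have 3: "card (fst ` G) \<le> card G" "card (snd ` G) \<le> card G" by (simp_all add: G card_image_le)
  show ?thesis
    using 1 2 3 by (intro order.trans[OF card_Un_le] order.trans[OF add_mono[OF card_Un_le order.refl]]
        order.trans[OF add_mono[OF add_mono[OF card_Un_le order.refl] order.refl]]) auto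
qed

text \<open>Double counting: exchanging \<open>x\<close> with a good \<open>d\<close> separates
  \<open>x\<close> from \<open>y\<close> and leaves \<open>d\<close> in the part of
  \<open>y\<close>, so each separated matching arises from at most \<open>r - 1\<close> choices of
  \<open>d\<close>. Only \<open>x\<close> and \<open>d\<close> move, hence \<open>y\<close> may
  occur in \<open>G\<close>. If the subtraction truncates to 0, the claim is trivial.\<close>

lemma switching_upper:
  assumes F: "F \<subseteq> mates" and G: "finite G" and x: "x \<in> P" and y: "y \<in> P" "x \<noteq> y"
    and xG: "x \<notin> fst ` G \<union> snd ` G"
  shows "(card P - (2 * K * r + 2 * card G)) * card {\<sigma> \<in> cfgs F G. together \<sigma> x y}
     \<le> (r - 1) * card {\<sigma> \<in> cfgs F G. \<not> together \<sigma> x y}"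
proof -
  define bad where "bad \<sigma> = {d. \<exists>e\<in>P. cell e = cell x \<and> d \<in> P \<and> together \<sigma> e d} \<union> 
      {d. \<exists>e\<in>P. together \<sigma> x e \<and> d \<in> P \<and> cell d = cell e} \<union> fst ` G \<union> snd ` G" for \<sigma>
  let ?A = "{\<sigma> \<in> cfgs F G. together \<sigma> x y}" and ?B = "{\<sigma> \<in> cfgs F G. \<not> together \<sigma> x y}"
  define L where "L = (SIGMA \<sigma>:?A. P - bad \<sigma>)"
  define R where "R = (SIGMA \<sigma>:?B. {d \<in> P. together \<sigma> y d \<and> d \<noteq> y})"
  define \<phi> where "\<phi> = (\<lambda>(\<sigma>, d). (swap x d \<sigma>, d))"
  have perm: "\<sigma> permutes P" if "\<sigma> \<in> cfgs F G" for \<sigma> using that by (simp add: cfgs_def)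
  have fin_bad: "finite (bad \<sigma>)" for \<sigma>
    unfolding bad_def using finite_P G by auto
  \<comment> \<open>Exchanging the same two points again undoes the exchange, so
    \<open>\<phi>\<close> is its own inverse.\<close>
  have "inj_on \<phi> L"
    by (rule inj_on_inverseI[where g = \<phi>]) (auto simp: \<phi>_def)
  moreover have "\<phi> ` L \<subseteq> R"
  proof (rule image_subsetI, clarify)
    fix \<sigma>' d' assume "(\<sigma>', d') \<in> L"
    then have *: "\<sigma>' \<in> cfgs F G" "together \<sigma>' x y" "d' \<in> P" "d' \<notin> bad \<sigma>'" by (auto simp: L_def)
    have c1: "\<not> together \<sigma>' e d'" if "e \<in> P" "cell e = cell x" for e
      using * that unfolding bad_def by blast
    have c2: "\<not> together \<sigma>' x e" if "e \<in> P" "cell e = cell d'" for e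
      using * that unfolding bad_def by (metis (mono_tags, lifting) UnCI mem_Collect_eq)
    have c3: "d' \<notin> fst ` G" "d' \<notin> snd ` G"
      using * unfolding bad_def by blast+
    have nxd: "\<not> together \<sigma>' x d'" using c1[OF x refl] .
    have "swap x d' \<sigma>' \<in> cfgs F G"
    proof (rule swap_in_cfgs[OF *(1) F x *(3)])
      fix u v assume uv: "(u, v) \<in> G"
      then have "u \<in> fst ` G" "v \<in> snd ` G" by (auto intro: rev_image_eqI)
      then show "x \<notin> {u, v} \<and> d' \<notin> {u, v}" using xG c3 by blast
    next
      fix e assume "e \<in> P" "cell e = cell x" then show "\<not> together \<sigma>' d' e"
        using c1[of e] unfolding together_def by metis
    next
      fix e assume "e \<in> P" "cell e = cell d'" then show "\<not> together \<sigma>' x e"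
        using c2 by blast
    qed
    moreover have "d' \<noteq> x" "d' \<noteq> y" using nxd *(2) by (auto simp: together_def)
    ultimately show "\<phi> (\<sigma>', d') \<in> R" using * nxd y by (auto simp: \<phi>_def R_def together_def)
  qed
  moreover have "finite R" unfolding R_def using finite_P by auto
  ultimately have "card L \<le> card R" by (rule card_inj_on_le)
  also have "card R = (r - 1) * card ?B"
    unfolding R_def using finite_P by (subst card_SigmaI) (auto simp: card_block_minus perm y)
  finally have "card L \<le> (r - 1) * card ?B" .
  moreover have "card L = (\<Sum>\<sigma>\<in>?A. card (P - bad \<sigma>))"
    unfolding L_def using finite_P by (subst card_SigmaI) auto
  moreover have "(\<Sum>\<sigma>\<in>?A. card P - (2 * K * r + 2 * card G)) \<le> (\<Sum>\<sigma>\<in>?A. card (P - bad \<sigma>))"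
  proof (rule sum_mono)
    fix \<sigma> assume "\<sigma> \<in> ?A"
    then have "card (bad \<sigma>) \<le> 2 * K * r + 2 * card G"
      unfolding bad_def using card_bad_swaps[OF _ x G] perm by auto
    then show "card P - (2 * K * r + 2 * card G) \<le> card (P - bad \<sigma>)"
      using diff_card_le_card_Diff[OF fin_bad, of P \<sigma>] by linarith
  qed
  ultimately show ?thesis by (simp add: mult.commute)
qed

end

section \<open>Matchings without loops\<close>

text \<open>Here \<open>A\<close> and \<open>B\<close> count the matchings that join and that
  separate a given pair, and \<open>q = A / N\<close> is the probability of joining it. The two
  switching inequalities confine \<open>q\<close> to \<open>(r - 1) / m\<close> up to
  \<open>6 * K * r^2 / m^2\<close>, and \<open>ln (1 - q)\<close> differs from \<open>-q\<close> by
  at most \<open>2 * q^2\<close>.\<close>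

lemma ln_ratio_estimate:
  fixes A B N m r K :: real
  assumes N: "N = A + B" "N > 0" and A: "A \<ge> 0" and r: "r \<ge> 1" and K: "K \<ge> 1" and m: "m \<ge> 4 * K * r"
    and upper: "(m - 2 * K * r) * A \<le> (r - 1) * B"
    and lower: "(r - 1) * B - (m - r) * A \<le> 6 * K * r^2 / m * N"
  shows "B > 0" "\<bar>ln (B / N) + (r - 1) / m\<bar> \<le> 14 * K * r^2 / m^2"
proof -
  define q where "q = A / N"
  have Kr: "K * r \<ge> 1" "K * r \<ge> r" using r K mult_mono[of 1 K 1 r] mult_right_mono[of 1 K r] by auto
  have m0: "m > 0" using Kr m by linarith
  have q0: "q \<ge> 0" using A N by (simp add: q_def)
  have AB: "A = q * N" "B = (1 - q) * N" using N by (simp_all add: q_def field_simps)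
  have "(m - 2 * K * r) * q * N \<le> (r - 1) * (1 - q) * N" using upper AB by (simp add: algebra_simps)
  then have u: "(m - 2 * K * r) * q \<le> (r - 1) * (1 - q)" using N(2) by simp
  have "((r - 1) * (1 - q) - (m - r) * q) * N \<le> (6 * K * r^2 / m) * N" 
    using lower AB by (simp add: algebra_simps)
  then have l: "(r - 1) * (1 - q) - (m - r) * q \<le> 6 * K * r^2 / m" using N(2) by (meson mult_right_le_imp_le)
  \<comment> \<open>A crude bound first: since \<open>m \<ge> 4 * K * r\<close>, the coefficient of
    \<open>q\<close> is at least \<open>m / 2\<close>. The resulting
    \<open>m * q \<le> 2 * r\<close> is then fed back to control the term
    \<open>2 * K * r * q\<close>.\<close>
  have "m / 2 * q \<le> (m - 2 * K * r) * q" using m q0 by (intro mult_right_mono) auto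
  also have "\<dots> \<le> (r - 1) * (1 - q)" by (rule u)
  also have "\<dots> \<le> (r - 1) * 1" using r q0 by (intro mult_left_mono) auto
  also have "\<dots> = r - 1" by simp
  finally have q2: "m * q \<le> 2 * (r - 1)" by simp
  then have q2': "m * q \<le> 2 * r" by simp
  have "m * q \<le> r - 1 + 2 * K * r * q"
  proof -
    have "m * q - 2 * K * r * q \<le> (r - 1) * (1 - q)" using u by (simp only: left_diff_distrib)
    also have "\<dots> \<le> (r - 1) * 1" using r q0 by (intro mult_left_mono) auto
    finally show ?thesis by simp
  qed
  also have "2 * K * r * q = 2 * K * r * (m * q) / m" using m0 by simp
  also have "\<dots> \<le> 2 * K * r * (2 * r) / m"
    using q2' m0 K r by (intro divide_right_mono mult_left_mono) auto
  finally have qu: "m * q - (r - 1) \<le> 4 * K * r^2 / m" by (simp add: power2_eq_square)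
  have "(r - 1) - m * q \<le> (r - 1) * (1 - q) - (m - r) * q" using q0 by (simp add: algebra_simps)
  with l have ql: "(r - 1) - m * q \<le> 6 * K * r^2 / m" by linarith
  have "4 * K * r^2 / m \<le> 6 * K * r^2 / m" using m0 K r by (intro divide_right_mono mult_right_mono) auto
  with qu ql have "\<bar>m * q - (r - 1)\<bar> \<le> 6 * K * r^2 / m" by linarith
  then have "\<bar>m * q - (r - 1)\<bar> / m \<le> 6 * K * r^2 / m / m" using m0 by (intro divide_right_mono) auto
  moreover have "\<bar>m * q - (r - 1)\<bar> / m = \<bar>q - (r - 1) / m\<bar>"
  proof -
    have "q - (r - 1) / m = (m * q - (r - 1)) / m" using m0 by (simp add: field_simps)
    then show ?thesis using m0 by (simp add: abs_divide)
  qed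
  ultimately have qq: "\<bar>q - (r - 1) / m\<bar> \<le> 6 * K * r^2 / m^2" by (simp add: power2_eq_square)
  \<comment> \<open>\<open>q \<le> 1 / 2\<close> is the range in which \<open>- q - 2 * q^2\<close>
    bounds \<open>ln (1 - q)\<close> from below. The constant 14 is 6 from the location of
    \<open>q\<close> plus 8 from \<open>2 * q^2\<close>.\<close>
  have qle: "q \<le> 2 * r / m" using q2' m0 by (simp add: field_simps)
  also have "\<dots> \<le> 2 * r / (4 * K * r)" using m Kr r m0 by (intro divide_left_mono mult_pos_pos) auto
  also have "\<dots> \<le> 1 / 2" using K r by (simp add: field_simps)
  finally have qh: "q \<le> 1 / 2" .
  then show "B > 0" using AB(2) N(2) by simp
  have "q^2 \<le> (2 * r / m)^2" using qle q0 by (intro power_mono)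
  also have "\<dots> = 4 * r^2 / m^2" by (simp add: power_divide power_mult_distrib)
  also have "\<dots> \<le> 4 * K * r^2 / m^2" using K m0 by (intro divide_right_mono mult_right_mono) auto
  finally have qs: "2 * q^2 \<le> 8 * K * r^2 / m^2" by simp
  have BN: "B / N = 1 - q" using AB(2) N(2) by simp
  have "ln (1 - q) \<le> - q" using ln_add_one_self_le_self2[of "-q"] qh by simp
  moreover have "- q - 2 * q^2 \<le> ln (1 - q)" using ln_one_minus_pos_lower_bound[OF q0 qh] .
  moreover have "14 * K * r^2 / m^2 = 6 * K * r^2 / m^2 + 8 * K * r^2 / m^2" by (simp add: field_simps)
  moreover have "8 * K * r^2 / m^2 \<ge> 0" using K by simp
  ultimately show "\<bar>ln (B / N) + (r - 1) / m\<bar> \<le> 14 * K * r^2 / m^2"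
    unfolding BN using qq qs by linarith
qed

section \<open>Forbidding pairs of cellmates one at a time\<close>

context configuration_model
begin

lemma card_cfgs_split: 
  "card (cfgs F G) = card {\<sigma> \<in> cfgs F G. together \<sigma> x y} + card {\<sigma> \<in> cfgs F G. \<not> together \<sigma> x y}"
proof -
  have "cfgs F G = {\<sigma> \<in> cfgs F G. together \<sigma> x y} \<union> {\<sigma> \<in> cfgs F G. \<not> together \<sigma> x y}" by auto
  then have "card (cfgs F G) = card ({\<sigma> \<in> cfgs F G. together \<sigma> x y} \<union> {\<sigma> \<in> cfgs F G. \<not> together \<sigma> x y})" by simp
  also have "\<dots> = card {\<sigma> \<in> cfgs F G. together \<sigma> x y} + card {\<sigma> \<in> cfgs F G. \<not> together \<sigma> x y}"
    by (rule card_Un_disjoint) auto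
  finally show ?thesis .
qed

lemma cfgs_insert: "cfgs F (insert (x, y) G) = {\<sigma> \<in> cfgs F G. together \<sigma> x y}"
  "cfgs (insert (x, y) F) G = {\<sigma> \<in> cfgs F G. \<not> together \<sigma> x y}"
  by (auto simp: cfgs_def)

lemma card_mates: "card mates \<le> card P * K"
proof -
  have "mates \<subseteq> (SIGMA x:P. {y \<in> P. cell y = cell x})" by (auto simp: mates_def)
  then have "card mates \<le> card (SIGMA x:P. {y \<in> P. cell y = cell x})" using finite_P by (intro card_mono) auto
  also have "\<dots> = (\<Sum>x\<in>P. card {y \<in> P. cell y = cell x})" using finite_P by simp
  also have "\<dots> \<le> (\<Sum>x\<in>P. K)" using card_cell by (intro sum_mono) auto
  finally show ?thesis by simp
qed

lemma finite_mates [simp]: "finite mates"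
  by (rule finite_subset[of _ "P \<times> P"]) (auto simp: mates_def finite_P)

end

text \<open>The bound makes \<open>2 * K * r + 6\<close> at most half of \<open>card P\<close>; this
  is the number of points that \<open>switching_upper\<close> discards when up to three pairs are
  forced.\<close>

locale sparse_configuration_model = configuration_model +
  assumes sparse: "card P \<ge> 4 * K * r + 12"
begin

lemma card_P_pos: "real (card P) > 0" using sparse by simp

text \<open>At least half of the points are good for the exchange, which costs a factor 2 in
  \<open>switching_upper\<close>. Because only the moved point \<open>x\<close> has to be absent
  from \<open>G\<close>, several pairs can be forced one after the other.\<close>

lemma force_pair:
  assumes F: "F \<subseteq> mates" and G: "finite G" "card G \<le> 3" and x: "x \<in> P" and y: "y \<in> P" "x \<noteq> y"
    and xG: "x \<notin> fst ` G \<union> snd ` G"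
  shows "real (card (cfgs F (insert (x, y) G))) \<le> 2 * real r / real (card P) * real (card (cfgs F G))"
proof -
  let ?A = "card {\<sigma> \<in> cfgs F G. together \<sigma> x y}" and ?B = "card {\<sigma> \<in> cfgs F G. \<not> together \<sigma> x y}"
  have "card P * ?A \<le> 2 * (card P - (2 * K * r + 2 * card G)) * ?A"
    using sparse G by (intro mult_right_mono) auto
  also have "\<dots> \<le> 2 * ((r - 1) * ?B)"
    using switching_upper[OF F G(1) x y xG] by simp
  also have "\<dots> \<le> 2 * (r * card (cfgs F G))" 
    by (intro mult_left_mono mult_mono) (auto intro: card_mono)
  finally have "real (card P * ?A) \<le> real (2 * (r * card (cfgs F G)))" by (rule of_nat_mono)
  then show ?thesis using card_P_pos by (simp add: cfgs_insert field_simps)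
qed

text \<open>The exchange run backwards: if \<open>a\<close> and \<open>b\<close> are separated,
  trading \<open>b\<close> with one of the \<open>r - 1\<close> other points \<open>d\<close> in the
  part of \<open>a\<close> joins them and leaves \<open>d\<close> outside that part, where only
  \<open>card P - r\<close> points are available. The trades that fail are rare, since each of them
  puts one or two specific pairs together, at a cost of \<open>2 * r / card P\<close> per
  pair.\<close>

lemma switching_lower:
  assumes F: "F \<subseteq> mates" and ab: "(a, b) \<in> mates" "(a, b) \<notin> F" "(b, a) \<notin> F"
  shows "real (r - 1) * real (card {\<sigma> \<in> cfgs F {}. \<not> together \<sigma> a b})
     - real (card P - r) * real (card {\<sigma> \<in> cfgs F {}. together \<sigma> a b})
     \<le> 6 * real K * real r ^ 2 / real (card P) * real (card (cfgs F {}))"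
proof -
  let ?A = "{\<sigma> \<in> cfgs F {}. together \<sigma> a b}" and ?B = "{\<sigma> \<in> cfgs F {}. \<not> together \<sigma> a b}"
  let ?N = "real (card (cfgs F {}))" and ?m = "real (card P)"
  have abP: "a \<in> P" "b \<in> P" "a \<noteq> b" "cell a = cell b" using ab by (auto simp: mates_def)
  have perm: "\<sigma> permutes P" if "\<sigma> \<in> cfgs F {}" for \<sigma> using that by (simp add: cfgs_def)
  define L where "L = (SIGMA \<sigma>:?A. P - {d \<in> P. together \<sigma> a d})"
  define R where "R = (SIGMA \<sigma>:?B. {d \<in> P. together \<sigma> a d \<and> d \<noteq> a})"
  define bad where "bad = {(\<sigma>, d) \<in> R. swap b d \<sigma> \<notin> cfgs F {}}"
  \<comment> \<open>a reverse exchange of \<open>b\<close> and \<open>d\<close> fails only if \<open>b\<close> meets a cellmate in the part of \<open>a\<close> (\<open>bad1\<close>) or \<open>d\<close>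
    meets one in the part of \<open>b\<close> (\<open>bad2\<close>)\<close>
  define E1 where "E1 = {e \<in> P. cell e = cell b \<and> e \<noteq> a}"
  define bad1 where "bad1 = (\<Union>e\<in>E1. SIGMA \<sigma>:cfgs F {(a, e)}. {d \<in> P. together \<sigma> a d \<and> d \<noteq> a})"
  define E2 where "E2 = {(d, e) \<in> mates. d \<noteq> a \<and> d \<noteq> b \<and> e \<noteq> a \<and> e \<noteq> b}"
  define bad2 where "bad2 = (\<Union>(d, e)\<in>E2. cfgs F {(d, a), (e, b)} \<times> {d})"
  define \<phi> where "\<phi> = (\<lambda>(\<sigma>, d). (swap b d \<sigma> :: 'a \<Rightarrow> 'a, d))"
  have finR: "finite R" unfolding R_def using finite_P by auto
  have cR: "card R = (r - 1) * card ?B"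
    unfolding R_def using finite_P by (subst card_SigmaI) (auto simp: card_block_minus perm abP)
  have cL: "card L = (card P - r) * card ?A"
  proof -
    have "card L = (\<Sum>\<sigma>\<in>?A. card (P - {d \<in> P. together \<sigma> a d}))"
      unfolding L_def using finite_P by (subst card_SigmaI) auto
    also have "\<dots> = (\<Sum>\<sigma>\<in>?A. card P - r)"
      using finite_P card_block[OF perm abP(1)] by (intro sum.cong refl, subst card_Diff_subset) auto
    finally show ?thesis by simp
  qed
  have "inj_on \<phi> (R - bad)"
    by (rule inj_on_inverseI[where g = \<phi>]) (auto simp: \<phi>_def)
  moreover have "\<phi> ` (R - bad) \<subseteq> L"
  proof (rule image_subsetI, clarify)
    fix \<sigma> d assume "(\<sigma>, d) \<in> R" "(\<sigma>, d) \<notin> bad"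
    then have *: "\<sigma> \<in> cfgs F {}" "\<not> together \<sigma> a b" "d \<in> P" "together \<sigma> a d" "d \<noteq> a" "swap b d \<sigma> \<in> cfgs F {}"
      by (auto simp: R_def bad_def)
    moreover have "d \<noteq> b" using * by auto
    ultimately show "\<phi> (\<sigma>, d) \<in> L" using abP by (auto simp: \<phi>_def L_def together_def)
  qed
  moreover have "finite L" unfolding L_def using finite_P by auto
  ultimately have "card (R - bad) \<le> card L" by (rule card_inj_on_le)
  then have main: "card R \<le> card L + card bad"
  proof -
    have "bad \<subseteq> R" by (auto simp: bad_def)
    then have "finite bad" using finR finite_subset by blast
    then have "card R - card bad \<le> card (R - bad)" by (rule diff_card_le_card_Diff)
    with \<open>card (R - bad) \<le> card L\<close> show ?thesis by linarith
  qed
  have E1: "card E1 \<le> K"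
  proof -
    have "card E1 \<le> card {e \<in> P. cell e = cell b}" unfolding E1_def using finite_P by (intro card_mono) auto
    then show ?thesis using card_cell[OF abP(2)] by linarith
  qed
  have E2: "card E2 \<le> card P * K"
    using card_mono[OF finite_mates, of E2] card_mates by (force simp: E2_def)
  have fin12: "finite E1" "finite E2" "finite bad1" "finite bad2"
  proof -
    show f: "finite E1" "finite E2" using finite_P finite_subset[of E2 mates] by (auto simp: E1_def E2_def)
    show "finite bad1" "finite bad2" unfolding bad1_def bad2_def using f finite_P by auto
  qed
  have "bad \<subseteq> bad1 \<union> bad2"
  proof clarify
    fix \<sigma> d assume *: "(\<sigma>, d) \<in> bad" "(\<sigma>, d) \<notin> bad2"
    then have 1: "\<sigma> \<in> cfgs F {}" "\<not> together \<sigma> a b" "d \<in> P" "together \<sigma> a d" "d \<noteq> a" "swap b d \<sigma> \<notin> cfgs F {}"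
      by (auto simp: R_def bad_def)
    have db: "d \<noteq> b" using 1 by auto
    have d_ok: "\<not> together \<sigma> b e" if "e \<in> P" "e \<noteq> d" "e \<noteq> b" "cell e = cell d" for e
    proof
      assume t: "together \<sigma> b e"
      then have "e \<noteq> a" using 1 by (auto simp: together_def)
      then have "(d, e) \<in> E2" using that 1 db by (auto simp: E2_def mates_def)
      moreover have "\<sigma> \<in> cfgs F {(d, a), (e, b)}" using 1 t by (auto simp: cfgs_def together_def)
      ultimately show False using *(2) by (auto simp: bad2_def)
    qed
    have "\<exists>e. e \<in> P \<and> e \<noteq> b \<and> cell e = cell b \<and> ((b, e) \<in> F \<or> (e, b) \<in> F) \<and> together \<sigma> d e"
      using swap_in_cfgs[OF 1(1) F abP(2) 1(3)] 1(6) d_ok by blast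
    then obtain e where e: "e \<in> P" "e \<noteq> b" "cell e = cell b" "(b, e) \<in> F \<or> (e, b) \<in> F" "together \<sigma> d e" by blast
    \<comment> \<open>\<open>F\<close> contains the pair of \<open>a\<close> and \<open>b\<close> in
      neither order, so the offending cellmate \<open>e\<close> of \<open>b\<close> is not
      \<open>a\<close>.\<close>
    then have "e \<in> E1" using ab by (auto simp: E1_def)
    moreover have "\<sigma> \<in> cfgs F {(a, e)}" using 1 e by (auto simp: cfgs_def together_def)
    ultimately show "(\<sigma>, d) \<in> bad1" using 1 by (auto simp: bad1_def)
  qed
  then have "card bad \<le> card (bad1 \<union> bad2)" using fin12 by (intro card_mono) auto
  also have "\<dots> \<le> card bad1 + card bad2" by (rule card_Un_le)
  finally have bad12: "card bad \<le> card bad1 + card bad2" .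
  define \<tau> where "\<tau> = 2 * real r / ?m"
  have \<tau>0: "\<tau> \<ge> 0" by (simp add: \<tau>_def)
  have single: "real (card (cfgs F {(x, y)})) \<le> \<tau> * ?N" if "x \<in> P" "y \<in> P" "x \<noteq> y" for x y
    using force_pair[OF F, of "{}" x y] that by (simp add: \<tau>_def)
  have b1: "real (card bad1) \<le> real K * (real r * (\<tau> * ?N))"
  proof -
    have "card bad1 \<le> (\<Sum>e\<in>E1. card (SIGMA \<sigma>:cfgs F {(a, e)}. {d \<in> P. together \<sigma> a d \<and> d \<noteq> a}))"
      unfolding bad1_def by (rule card_UN_le[OF fin12(1)])
    also have "\<dots> = (\<Sum>e\<in>E1. (r - 1) * card (cfgs F {(a, e)}))"
    proof (rule sum.cong[OF refl])
      fix e
      have "\<sigma> permutes P" if "\<sigma> \<in> cfgs F {(a, e)}" for \<sigma> using that by (simp add: cfgs_def)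
      then show "card (SIGMA \<sigma>:cfgs F {(a, e)}. {d \<in> P. together \<sigma> a d \<and> d \<noteq> a}) = (r - 1) * card (cfgs F {(a, e)})"
        using finite_P by (subst card_SigmaI) (auto simp: card_block_minus abP)
    qed
    finally have "real (card bad1) \<le> real (\<Sum>e\<in>E1. (r - 1) * card (cfgs F {(a, e)}))" by (rule of_nat_mono)
    also have "\<dots> = (\<Sum>e\<in>E1. real (r - 1) * real (card (cfgs F {(a, e)})))" by simp
    also have "\<dots> \<le> (\<Sum>e\<in>E1. real r * (\<tau> * ?N))"
      using abP by (intro sum_mono mult_mono single) (auto simp: E1_def)
    also have "\<dots> = real (card E1) * (real r * (\<tau> * ?N))" by simp
    also have "\<dots> \<le> real K * (real r * (\<tau> * ?N))" using E1 \<tau>0 by (intro mult_right_mono) auto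
    finally show ?thesis .
  qed
  have b2: "real (card bad2) \<le> (?m * real K) * (\<tau> * (\<tau> * ?N))"
  proof -
    have "card bad2 \<le> (\<Sum>p\<in>E2. card (case p of (d, e) \<Rightarrow> cfgs F {(d, a), (e, b)} \<times> {d}))"
      unfolding bad2_def by (rule card_UN_le[OF fin12(2)])
    then have "real (card bad2) \<le> real (\<Sum>p\<in>E2. card (case p of (d, e) \<Rightarrow> cfgs F {(d, a), (e, b)} \<times> {d}))" 
      by (rule of_nat_mono)
    also have "\<dots> = (\<Sum>p\<in>E2. real (card (case p of (d, e) \<Rightarrow> cfgs F {(d, a), (e, b)} \<times> {d})))" by simp
    also have "\<dots> \<le> (\<Sum>p\<in>E2. \<tau> * (\<tau> * ?N))"
    proof (rule sum_mono, clarify)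
      fix d e assume "(d, e) \<in> E2"
      then have de: "d \<in> P" "e \<in> P" "d \<noteq> e" "d \<noteq> a" "d \<noteq> b" "e \<noteq> a" "e \<noteq> b" by (auto simp: E2_def mates_def)
      \<comment> \<open>The pair \<open>(d, a)\<close> is removed first: its moved point
        \<open>d\<close> is neither \<open>e\<close> nor \<open>b\<close>, as
        \<open>force_pair\<close> demands.\<close>
      have "real (card (cfgs F {(d, a), (e, b)})) \<le> \<tau> * real (card (cfgs F {(e, b)}))"
        using force_pair[OF F, of "{(e, b)}" d a] de abP by (simp add: \<tau>_def)
      also have "\<dots> \<le> \<tau> * (\<tau> * ?N)" using de abP \<tau>0 by (intro mult_left_mono single) auto
      finally show "real (card (cfgs F {(d, a), (e, b)} \<times> {d})) \<le> \<tau> * (\<tau> * ?N)" by (simp add: card_cartesian_product)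
    qed
    also have "\<dots> = real (card E2) * (\<tau> * (\<tau> * ?N))" by simp
    also have "\<dots> \<le> real (card P * K) * (\<tau> * (\<tau> * ?N))" using E2 \<tau>0 by (intro mult_right_mono of_nat_mono) auto
    finally show ?thesis by simp
  qed
  have "real (r - 1) * real (card ?B) - real (card P - r) * real (card ?A) \<le> real (card bad)"
    using of_nat_mono[OF main, where 'a = real] cL cR by simp
  also have "\<dots> \<le> real (card bad1) + real (card bad2)" using of_nat_mono[OF bad12, where 'a = real] by simp
  also have "\<dots> \<le> real K * (real r * (\<tau> * ?N)) + (?m * real K) * (\<tau> * (\<tau> * ?N))" using b1 b2 by simp
  \<comment> \<open>The factor 6 is 2 from \<open>bad1\<close> plus 4 from
    \<open>bad2\<close>.\<close>
  also have "\<dots> = 6 * real K * real r ^ 2 / ?m * ?N"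
    using card_P_pos by (simp add: \<tau>_def field_simps power2_eq_square)
  finally show ?thesis .
qed

lemma avoid_one_more_pair:
  assumes F: "F \<subseteq> mates" and ab: "(a, b) \<in> mates" "(a, b) \<notin> F" "(b, a) \<notin> F"
    and pos: "card (cfgs F {}) > 0"
  shows "card (cfgs (insert (a, b) F) {}) > 0"
    "\<bar>ln (real (card (cfgs (insert (a, b) F) {})) / real (card (cfgs F {}))) + (real r - 1) / real (card P)\<bar>
      \<le> 14 * real K * real r ^ 2 / real (card P) ^ 2"
proof -
  let ?A = "card {\<sigma> \<in> cfgs F {}. together \<sigma> a b}" and ?B = "card {\<sigma> \<in> cfgs F {}. \<not> together \<sigma> a b}"
  have abP: "a \<in> P" "b \<in> P" "a \<noteq> b" using ab by (auto simp: mates_def)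
  have r: "real (r - 1) = real r - 1" using r_ge_3 by simp
  have "1 * r \<le> K * r" using K_pos by (intro mult_right_mono) auto
  then have Kr: "r \<le> K * r" by simp
  have "real ((card P - 2 * K * r) * ?A) \<le> real ((r - 1) * ?B)"
    using switching_upper[OF F, of "{}" a b] abP by (intro of_nat_mono) simp
  then have 1: "(real (card P) - 2 * real K * real r) * real ?A \<le> (real r - 1) * real ?B"
    using sparse r by (simp add: of_nat_diff)
  have 2: "(real r - 1) * real ?B - (real (card P) - real r) * real ?A
     \<le> 6 * real K * real r ^ 2 / real (card P) * real (card (cfgs F {}))"
    using switching_lower[OF F ab] sparse Kr r by (simp add: of_nat_diff)
  have "real (4 * K * r) \<le> real (card P)" using sparse by (intro of_nat_mono) simp
  then have 3: "4 * real K * real r \<le> real (card P)" by simp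
  have 4: "real (card (cfgs F {})) = real ?A + real ?B" using card_cfgs_split[of F "{}" a b] by simp
  note est = ln_ratio_estimate[OF 4 _ _ _ _ 3 1 2]
  have "real ?B > 0" using est(1) pos r_ge_3 K_pos by simp
  then show "card (cfgs (insert (a, b) F) {}) > 0" by (simp add: cfgs_insert)
  show "\<bar>ln (real (card (cfgs (insert (a, b) F) {})) / real (card (cfgs F {}))) + (real r - 1) / real (card P)\<bar>
      \<le> 14 * real K * real r ^ 2 / real (card P) ^ 2"
    using est(2) pos r_ge_3 K_pos by (simp add: cfgs_insert)
qed

text \<open>In logarithms the product of the successive proportions becomes a sum, starting from all
  \<open>fact (card P)\<close> permutations. Taking pairs in increasing order only ensures that the
  reverse of a new pair is never already in \<open>F\<close>, which the single step
  requires.\<close>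

lemma avoid_pairs:
  assumes "F \<subseteq> {(a, b) \<in> mates. a < b}"
  shows "card (cfgs F {}) > 0 \<and> 
    \<bar>ln (real (card (cfgs F {})) / fact (card P)) + real (card F) * ((real r - 1) / real (card P))\<bar>
      \<le> real (card F) * (14 * real K * real r ^ 2 / real (card P) ^ 2)"
proof -
  have "finite F" using assms finite_subset[OF _ finite_mates, of F] by auto
  then show ?thesis using assms
  proof (induction F)
    case empty
    have "cfgs {} {} = {\<sigma>. \<sigma> permutes P}" by (simp add: cfgs_def)
    then have "card (cfgs {} {}) = fact (card P)" using card_permutations[OF refl finite_P] by simp
    then show ?case by simp
  next
    case (insert p F)
    obtain a b where p: "p = (a, b)" by force
    have *: "F \<subseteq> mates" "(a, b) \<in> mates" "(a, b) \<notin> F" "(b, a) \<notin> F" using insert p by auto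
    let ?N = "real (card (cfgs F {}))" and ?N' = "real (card (cfgs (insert p F) {}))"
    have IH: "card (cfgs F {}) > 0" 
      "\<bar>ln (?N / fact (card P)) + real (card F) * ((real r - 1) / real (card P))\<bar>
      \<le> real (card F) * (14 * real K * real r ^ 2 / real (card P) ^ 2)" using insert by auto
    note step = avoid_one_more_pair[OF * IH(1), folded p]
    have "ln (?N' / fact (card P)) = ln (?N' / ?N) + ln (?N / fact (card P))"
    proof -
      have pos: "?N' > 0" "?N > 0" "(fact (card P) :: real) > 0"
        using step(1) IH(1) by (simp_all only: of_nat_0_less_iff fact_gt_zero)
      show ?thesis
        unfolding ln_divide_pos[OF pos(1,3)] ln_divide_pos[OF pos(1,2)] ln_divide_pos[OF pos(2,3)] by simp
    qed
    moreover have "real (card (insert p F)) * c = c + real (card F) * c" for c :: real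
      using insert.hyps by (simp add: algebra_simps)
    ultimately show ?case using step IH(2) by (auto simp: add_divide_distrib)
  qed
qed

end

section \<open>Matchings without repeated edges\<close>

text \<open>Converts a failure probability of at most \<open>x\<close> into an error of at most
  \<open>2 * x\<close> in the logarithm; applied to repeated edges and later to the edges of
  \<open>X\<close>.\<close>

lemma ln_one_minus_small:
  fixes x y :: real
  assumes "0 \<le> y" "y \<le> x" "x \<le> 1 / 2"
  shows "- 2 * x \<le> ln (1 - y)" "ln (1 - y) \<le> 0"
proof -
  have "2 * y * y \<le> 1 * y" using assms by (intro mult_right_mono) auto
  then have "- y - 2 * y^2 \<ge> - 2 * y" by (simp add: power2_eq_square)
  with ln_one_minus_pos_lower_bound[of y] show "- 2 * x \<le> ln (1 - y)" using assms by linarith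
  show "ln (1 - y) \<le> 0" using assms by simp
qed

context configuration_model
begin

text \<open>Two different parts are represented by points \<open>x\<close> and \<open>y\<close>
  lying in them, so that the condition can be expressed through forced pairs. In a loop-free
  matching the two equal cell sets are a repeated edge.\<close>

definition repeated :: "('p \<Rightarrow> 'p) \<Rightarrow> bool" where
  "repeated \<sigma> \<longleftrightarrow> (\<exists>x\<in>P. \<exists>y\<in>P. \<not> together \<sigma> x y \<and>
      cell ` {d \<in> P. together \<sigma> x d} = cell ` {d \<in> P. together \<sigma> y d})"

definition simple_cfgs :: "('p \<Rightarrow> 'p) set" where
  "simple_cfgs = {\<sigma> \<in> cfgs mates {}. \<not> repeated \<sigma>}"

lemma card_mates_half: "2 * card {(a, b) \<in> mates. a < b} = card mates"
proof -
  let ?D = "{(a, b) \<in> mates. a < b}"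
  have fin: "finite ?D" by (rule finite_subset[OF _ finite_mates]) auto
  have "mates = ?D \<union> prod.swap ` ?D"
  proof (intro equalityI subsetI)
    fix p assume p: "p \<in> mates"
    obtain a b where ab: "p = (a, b)" by force
    have "a \<noteq> b" "(b, a) \<in> mates" using p ab by (auto simp: mates_def)
    then consider "a < b" | "b < a" "(b, a) \<in> ?D" by force
    then show "p \<in> ?D \<union> prod.swap ` ?D"
    proof cases
      case 2 then show ?thesis using ab by (auto intro!: rev_image_eqI[of "(b, a)"])
    qed (use p ab in auto)
  qed (auto simp: mates_def)
  then have "card mates = card (?D \<union> prod.swap ` ?D)" by metis
  also have "\<dots> = card ?D + card (prod.swap ` ?D)"
    by (rule card_Un_disjoint) (use fin in auto)
  also have "card (prod.swap ` ?D) = card ?D" by (intro card_image inj_onI) auto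
  finally show ?thesis by simp
qed

text \<open>Sharing a part is symmetric, so forbidding each pair in one order forbids both; this
  connects loop-freeness with \<open>avoid_pairs\<close>.\<close>

lemma cfgs_mates: "cfgs mates {} = cfgs {(a, b) \<in> mates. a < b} {}"
proof -
  have "\<not> together \<sigma> x y" 
    if "\<forall>(a, b)\<in>{(a, b) \<in> mates. a < b}. \<not> together \<sigma> a b" "(x, y) \<in> mates" for \<sigma> x y
  proof -
    have "(y, x) \<in> mates" "x \<noteq> y" using that by (auto simp: mates_def)
    then consider "x < y" | "y < x" by force
    then show ?thesis using that \<open>(y, x) \<in> mates\<close> by cases (fastforce simp: together_def)+
  qed
  then show ?thesis unfolding cfgs_def by blast
qed

end

context sparse_configuration_model
begin

text \<open>A union bound with four forced pairs per triple of cellmate pairs. Three pairs are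
  essential to the estimate: two pairs would only give \<open>(m * K)^2 * (2 * r / m)^2\<close>,
  which does not tend to 0, whereas the third brings a factor \<open>m * K\<close> against two
  further factors \<open>2 * r / m\<close>.\<close>

lemma card_repeated:
  "real (card {\<sigma> \<in> cfgs mates {}. repeated \<sigma>})
    \<le> 16 * real r ^ 4 * real K ^ 3 / real (card P) * real (card (cfgs mates {}))"
proof -
  let ?N = "real (card (cfgs mates {}))" and ?m = "real (card P)"
  define \<tau> where "\<tau> = 2 * real r / ?m"
  have \<tau>0: "\<tau> \<ge> 0" by (simp add: \<tau>_def)
  \<comment> \<open>three points \<open>a, b, c\<close> of one part and their cellmates in the other; the forced pairs are listed so that
    the first component of each does not occur in the later ones, as \<open>force_pair\<close> requires\<close>
  define T where "T = {((a, a'), (b, b'), (c, c')). (a, a') \<in> mates \<and> (b, b') \<in> mates \<and> (c, c') \<in> mates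
    \<and> distinct [a, a', b, b', c, c']}"
  define S where "S = (\<lambda>((a, a'), (b, b'), (c, c')). cfgs mates {(c', a'), (c, a), (b', a'), (b, a)})"
  have Tsub: "T \<subseteq> mates \<times> mates \<times> mates" by (auto simp: T_def)
  have finT: "finite T" using Tsub by (rule finite_subset) auto
  have "card T \<le> card (mates \<times> mates \<times> mates)" using Tsub by (intro card_mono) auto
  also have "\<dots> = card mates ^ 3" by (simp add: card_cartesian_product power3_eq_cube)
  also have "\<dots> \<le> (card P * K) ^ 3" using card_mates by (rule power_mono) simp
  finally have cT: "card T \<le> (card P * K) ^ 3" .
  have "{\<sigma> \<in> cfgs mates {}. repeated \<sigma>} \<subseteq> (\<Union>p\<in>T. S p)"
  proof clarify
    fix \<sigma> assume \<sigma>: "\<sigma> \<in> cfgs mates {}" and "repeated \<sigma>"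
    then obtain x y where xy: "x \<in> P" "y \<in> P" "\<not> together \<sigma> x y"
      "cell ` {d \<in> P. together \<sigma> x d} = cell ` {d \<in> P. together \<sigma> y d}" by (auto simp: repeated_def)
    have perm: "\<sigma> permutes P" and noloop: "\<And>u v. (u, v) \<in> mates \<Longrightarrow> \<not> together \<sigma> u v"
      using \<sigma> by (auto simp: cfgs_def)
    have "3 \<le> card {d \<in> P. together \<sigma> x d}" using card_block[OF perm xy(1)] r_ge_3 by simp
    then obtain U where U: "U \<subseteq> {d \<in> P. together \<sigma> x d}" "card U = 3" by (rule obtain_subset_with_card_n)
    then obtain a b c where abc: "U = {a, b, c}" "a \<noteq> b" "b \<noteq> c" "a \<noteq> c" unfolding card_3_iff by blast
    have ABC: "a \<in> P" "b \<in> P" "c \<in> P" "together \<sigma> x a" "together \<sigma> x b" "together \<sigma> x c"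
      using U(1) unfolding abc(1) by auto
    have ex: "\<exists>d'. d' \<in> P \<and> together \<sigma> y d' \<and> cell d = cell d'" if "d \<in> P" "together \<sigma> x d" for d
    proof -
      have "cell d \<in> cell ` {d \<in> P. together \<sigma> y d}" using that xy(4)[symmetric] by blast
      then show ?thesis by blast
    qed
    obtain a' where a': "a' \<in> P" "together \<sigma> y a'" "cell a = cell a'" using ex ABC by blast
    obtain b' where b': "b' \<in> P" "together \<sigma> y b'" "cell b = cell b'" using ex ABC by blast
    obtain c' where c': "c' \<in> P" "together \<sigma> y c'" "cell c = cell c'" using ex ABC by blast
    have tog: "together \<sigma> a b" "together \<sigma> b c" "together \<sigma> a c" using ABC by (auto simp: together_def)
    \<comment> \<open>Loop-freeness puts \<open>a\<close>, \<open>b\<close>, \<open>c\<close> into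
      different cells, and the two parts are disjoint, so all six points are distinct.\<close>
    have "cell a \<noteq> cell b" using noloop[of a b] ABC abc tog by (auto simp: mates_def)
    moreover have "cell b \<noteq> cell c" using noloop[of b c] ABC abc tog by (auto simp: mates_def)
    moreover have "cell a \<noteq> cell c" using noloop[of a c] ABC abc tog by (auto simp: mates_def)
    moreover have "u \<noteq> v" if "together \<sigma> x u" "together \<sigma> y v" for u v
      using that xy(3) by (auto simp: together_def)
    ultimately have "((a, a'), (b, b'), (c, c')) \<in> T"
      using a' b' c' ABC abc by (auto simp: T_def mates_def)
    moreover have "\<sigma> \<in> S ((a, a'), (b, b'), (c, c'))"
      using \<sigma> a' b' c' ABC by (auto simp: S_def cfgs_def together_def)
    ultimately show "\<sigma> \<in> (\<Union>p\<in>T. S p)" by blast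
  qed
  moreover have "finite (\<Union>p\<in>T. S p)" using finT by (auto simp: S_def split: prod.splits)
  ultimately have "card {\<sigma> \<in> cfgs mates {}. repeated \<sigma>} \<le> card (\<Union>p\<in>T. S p)" by (intro card_mono)
  also have "\<dots> \<le> (\<Sum>p\<in>T. card (S p))" using finT by (rule card_UN_le)
  finally have "real (card {\<sigma> \<in> cfgs mates {}. repeated \<sigma>}) \<le> real (\<Sum>p\<in>T. card (S p))" by (rule of_nat_mono)
  also have "\<dots> = (\<Sum>p\<in>T. real (card (S p)))" by simp
  also have "\<dots> \<le> (\<Sum>p\<in>T. \<tau>^4 * ?N)"
  proof (rule sum_mono)
    fix p assume pT: "p \<in> T"
    obtain a a' b b' c c' where p: "p = ((a, a'), (b, b'), (c, c'))" by (metis surj_pair)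
    have mem: "a \<in> P" "a' \<in> P" "b \<in> P" "b' \<in> P" "c \<in> P" "c' \<in> P" 
      and dist: "distinct [a, a', b, b', c, c']" using pT p by (auto simp: T_def mates_def)
    have "real (card (cfgs mates {(c', a'), (c, a), (b', a'), (b, a)}))
      \<le> \<tau> * real (card (cfgs mates {(c, a), (b', a'), (b, a)}))"
      \<comment> \<open>This first removal leaves three forced pairs, the most that
        \<open>force_pair\<close> admits.\<close>
      unfolding \<tau>_def using mem dist card_insert_le_m1
      by (intro force_pair) (auto simp: card_insert_if)
    also have "\<dots> \<le> \<tau> * (\<tau> * real (card (cfgs mates {(b', a'), (b, a)})))"
      using mem dist \<tau>0 by (intro mult_left_mono force_pair[folded \<tau>_def]) (auto simp: card_insert_if)
    also have "\<dots> \<le> \<tau> * (\<tau> * (\<tau> * real (card (cfgs mates {(b, a)}))))"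
      using mem dist \<tau>0 by (intro mult_left_mono force_pair[folded \<tau>_def]) (auto simp: card_insert_if)
    also have "\<dots> \<le> \<tau> * (\<tau> * (\<tau> * (\<tau> * ?N)))"
      using mem dist \<tau>0 by (intro mult_left_mono force_pair[folded \<tau>_def]) (auto simp: card_insert_if)
    finally show "real (card (S p)) \<le> \<tau>^4 * ?N" by (simp add: S_def p power4_eq_xxxx mult.assoc)
  qed
  also have "\<dots> = real (card T) * (\<tau>^4 * ?N)" by simp
  also have "\<dots> \<le> real ((card P * K) ^ 3) * (\<tau>^4 * ?N)"
    using cT \<tau>0 by (intro mult_right_mono of_nat_mono) auto
  also have "\<dots> = 16 * real r ^ 4 * real K ^ 3 / ?m * ?N"
    using card_P_pos by (simp add: \<tau>_def field_simps eval_nat_numeral)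
  finally show ?thesis .
qed

lemma card_simple_cfgs:
  assumes m: "32 * real r ^ 4 * real K ^ 3 \<le> real (card P)"
  shows "card simple_cfgs > 0"
    "\<bar>ln (real (card simple_cfgs) / fact (card P)) + real (card mates) * (real r - 1) / (2 * real (card P))\<bar>
      \<le> 40 * real r ^ 4 * real K ^ 3 / real (card P)"
proof -
  define D where "D = {(a, b) \<in> mates. a < b}"
  define \<epsilon> where "\<epsilon> = real r ^ 4 * real K ^ 3 / real (card P)"
  let ?N = "real (card (cfgs mates {}))" and ?m = "real (card P)" and ?S = "real (card simple_cfgs)"
  have cD: "real (card D) = real (card mates) / 2"
    using card_mates_half unfolding D_def by linarith
  have avoid: "card (cfgs mates {}) > 0" 
    "\<bar>ln (?N / fact (card P)) + real (card D) * ((real r - 1) / ?m)\<bar>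
      \<le> real (card D) * (14 * real K * real r ^ 2 / ?m ^ 2)"
    using avoid_pairs[of D] unfolding cfgs_mates D_def by blast+
  have N0: "?N > 0" using avoid(1) by (simp only: of_nat_0_less_iff)
  have "real (card D) * (14 * real K * real r ^ 2 / ?m ^ 2) 
      \<le> (?m * real K / 2) * (14 * real K * real r ^ 2 / ?m ^ 2)"
    using cD of_nat_mono[OF card_mates, where 'a = real] by (intro mult_right_mono) auto
  also have "\<dots> = 7 * (real r ^ 2 * real K ^ 2) / ?m" using card_P_pos by (simp add: field_simps eval_nat_numeral)
  also have "\<dots> \<le> 7 * (real r ^ 4 * real K ^ 3) / ?m"
    using r_ge_3 K_pos by (intro divide_right_mono mult_left_mono mult_mono power_increasing) auto
  finally have e1: "real (card D) * (14 * real K * real r ^ 2 / ?m ^ 2) \<le> 7 * \<epsilon>" by (simp add: \<epsilon>_def)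
  \<comment> \<open>The constant 32 in the hypothesis is chosen so that the proportion
    \<open>16 * \<epsilon>\<close> of matchings with repeated edges is at most
    \<open>1 / 2\<close>.\<close>
  have \<epsilon>: "0 \<le> \<epsilon>" "16 * \<epsilon> \<le> 1 / 2" using m card_P_pos by (auto simp: \<epsilon>_def field_simps)
  let ?R = "real (card {\<sigma> \<in> cfgs mates {}. repeated \<sigma>})"
  have "simple_cfgs = cfgs mates {} - {\<sigma> \<in> cfgs mates {}. repeated \<sigma>}" by (auto simp: simple_cfgs_def)
  then have "card simple_cfgs = card (cfgs mates {}) - card {\<sigma> \<in> cfgs mates {}. repeated \<sigma>}"
    by (simp add: card_Diff_subset)
  moreover have "card {\<sigma> \<in> cfgs mates {}. repeated \<sigma>} \<le> card (cfgs mates {})" by (intro card_mono) auto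
  ultimately have S: "?S = ?N - ?R" by simp
  have R: "?R \<le> 16 * \<epsilon> * ?N" using card_repeated by (simp add: \<epsilon>_def mult.assoc)
  have y: "0 \<le> ?R / ?N" "?R / ?N \<le> 16 * \<epsilon>" using R N0 by (auto simp: field_simps)
  have SN: "?S / ?N = 1 - ?R / ?N" unfolding S diff_divide_distrib using N0 by (subst divide_self) linarith+
  then have "?S / ?N > 0" using y \<epsilon> by linarith
  then have S0: "?S > 0" using N0 by (simp add: zero_less_divide_iff)
  then show "card simple_cfgs > 0" by (simp only: of_nat_0_less_iff)
  have e2: "- 32 * \<epsilon> \<le> ln (?S / ?N)" "ln (?S / ?N) \<le> 0"
    using ln_one_minus_small[OF y \<epsilon>(2)] unfolding SN by simp_all
  have f: "(fact (card P) :: real) > 0" by simp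
  have "ln (?S / fact (card P)) = ln (?S / ?N) + ln (?N / fact (card P))"
    unfolding ln_divide_pos[OF S0 f] ln_divide_pos[OF S0 N0] ln_divide_pos[OF N0 f] by simp
  moreover have "real (card D) * ((real r - 1) / ?m) = real (card mates) * (real r - 1) / (2 * ?m)"
    unfolding cD by simp
  \<comment> \<open>The loops contribute \<open>7 * \<epsilon>\<close> and the repeated edges
    \<open>32 * \<epsilon>\<close>; 40 is a rounding of the sum.\<close>
  ultimately have "\<bar>ln (?S / fact (card P)) + real (card mates) * (real r - 1) / (2 * ?m)\<bar> \<le> 40 * \<epsilon>"
    using avoid(2) e1 e2 \<epsilon> by linarith
  then show "\<bar>ln (?S / fact (card P)) + real (card mates) * (real r - 1) / (2 * ?m)\<bar>
      \<le> 40 * real r ^ 4 * real K ^ 3 / ?m" by (simp add: \<epsilon>_def)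
qed

end

section \<open>Matchings that realise a given hypergraph\<close>

text \<open>The functions are extensional, so two members that agree on \<open>A\<close> are equal
  and the cardinality is meaningful.\<close>

definition colour_bijs :: "'a set \<Rightarrow> ('a \<Rightarrow> 'c) \<Rightarrow> 'b set \<Rightarrow> ('b \<Rightarrow> 'c) \<Rightarrow> ('a \<Rightarrow> 'b) set" where
  "colour_bijs A c B d = {f \<in> A \<rightarrow>\<^sub>E B. bij_betw f A B \<and> (\<forall>a\<in>A. d (f a) = c a)}"

lemma card_inj_on_same_card:
  assumes "finite A" "finite B" "card A = card B"
  shows "card {f \<in> A \<rightarrow>\<^sub>E B. inj_on f A} = fact (card A)"
  using card_inj_on_subset_funcset[of A B A] assms by (simp add: fact_prod_rev)

text \<open>A colour-preserving bijection amounts to independent bijections between corresponding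
  colour classes: \<open>\<Phi>\<close> restricts to the classes and \<open>\<Psi>\<close> glues.
  Equality of \<open>card A\<close> and \<open>card B\<close> leaves no room in \<open>B\<close> for
  colours outside \<open>I\<close>.\<close>

lemma card_colour_bijs:
  fixes c :: "'a \<Rightarrow> 'c" and d :: "'b \<Rightarrow> 'c"
  assumes fin: "finite A" "finite B" "finite I" and I: "c ` A \<subseteq> I"
    and eq: "\<And>v. v \<in> I \<Longrightarrow> card {a \<in> A. c a = v} = card {b \<in> B. d b = v}"
    and AB: "card A = card B"
  shows "card (colour_bijs A c B d) = (\<Prod>v\<in>I. fact (card {a \<in> A. c a = v}))"
proof -
  let ?A = "\<lambda>v. {a \<in> A. c a = v}" and ?B = "\<lambda>v. {b \<in> B. d b = v}"
  define S where "S v = {f \<in> ?A v \<rightarrow>\<^sub>E ?B v. inj_on f (?A v)}" for v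
  define \<Phi> where "\<Phi> = (\<lambda>f :: 'a \<Rightarrow> 'b. \<lambda>v\<in>I. restrict f (?A v))"
  define \<Psi> where "\<Psi> = (\<lambda>g :: 'c \<Rightarrow> 'a \<Rightarrow> 'b. \<lambda>a\<in>A. g (c a) a)"
  have cI: "c a \<in> I" if "a \<in> A" for a using I that by blast
  have "bij_betw \<Phi> (colour_bijs A c B d) (PiE I S)"
  proof (rule bij_betw_byWitness[where f' = \<Psi>])
    show "\<forall>f\<in>colour_bijs A c B d. \<Psi> (\<Phi> f) = f"
    proof
      fix f assume "f \<in> colour_bijs A c B d"
      then have "f \<in> A \<rightarrow>\<^sub>E B" by (simp add: colour_bijs_def)
      then show "\<Psi> (\<Phi> f) = f"
        using cI by (intro ext) (auto simp: \<Phi>_def \<Psi>_def PiE_def extensional_def)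
    qed
    show "\<forall>g\<in>PiE I S. \<Phi> (\<Psi> g) = g"
    proof
      fix g assume g: "g \<in> PiE I S"
      show "\<Phi> (\<Psi> g) = g"
      proof (rule ext, rule ext)
        fix v a
        show "\<Phi> (\<Psi> g) v a = g v a"
        proof (cases "v \<in> I")
          case True
          then have "g v \<in> ?A v \<rightarrow>\<^sub>E ?B v" using PiE_mem[OF g True] by (simp add: S_def)
          \<comment> \<open>Off its colour class \<open>g v\<close> has the default value, exactly
            as the restriction of the glued function does.\<close>
          then have "g v a = undefined" if "a \<notin> ?A v" using that by (rule PiE_arb)
          then show ?thesis using True by (auto simp: \<Phi>_def \<Psi>_def restrict_def)
        next
          case False
          then show ?thesis using PiE_arb[OF g False] by (simp add: \<Phi>_def)
        qed
      qed
    qed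
    show "\<Phi> ` colour_bijs A c B d \<subseteq> PiE I S"
      by (rule image_subsetI) (auto simp: \<Phi>_def colour_bijs_def S_def bij_betw_def intro: inj_on_subset)
    show "\<Psi> ` PiE I S \<subseteq> colour_bijs A c B d"
    proof (rule image_subsetI)
      fix g assume g: "g \<in> PiE I S"
      have gS: "g (c a) a \<in> B" "d (g (c a) a) = c a" "inj_on (g (c a)) (?A (c a))" if "a \<in> A" for a
      proof -
        have "g (c a) \<in> S (c a)" using PiE_mem[OF g cI[OF that]] .
        then show "g (c a) a \<in> B" "d (g (c a) a) = c a" "inj_on (g (c a)) (?A (c a))" 
          using that by (auto simp: S_def PiE_def Pi_def)
      qed
      have inj: "inj_on (\<Psi> g) A"
      proof (rule inj_onI)
        fix a b assume ab: "a \<in> A" "b \<in> A" "\<Psi> g a = \<Psi> g b"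
        then have e: "g (c a) a = g (c b) b" by (simp add: \<Psi>_def)
        then have "c a = c b" using gS(2)[OF ab(1)] gS(2)[OF ab(2)] by metis
        then show "a = b" using gS(3)[OF ab(1)] e ab by (auto dest: inj_onD)
      qed
      have "\<Psi> g ` A \<subseteq> B" using gS(1) by (auto simp: \<Psi>_def)
      moreover have "card (\<Psi> g ` A) = card B" using inj AB by (simp add: card_image)
      ultimately have "\<Psi> g ` A = B" using fin by (simp add: card_subset_eq)
      then show "\<Psi> g \<in> colour_bijs A c B d" 
        using inj gS by (auto simp: colour_bijs_def bij_betw_def \<Psi>_def)
    qed
  qed
  then have "card (colour_bijs A c B d) = card (PiE I S)" by (rule bij_betw_same_card)
  also have "\<dots> = (\<Prod>v\<in>I. card (S v))" using fin by (simp add: card_PiE)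
  also have "\<dots> = (\<Prod>v\<in>I. fact (card (?A v)))"
    using fin eq unfolding S_def by (intro prod.cong refl card_inj_on_same_card) auto
  finally show ?thesis .
qed

lemma card_eq_sum_fibres:
  assumes "finite A" "finite I" "f ` A \<subseteq> I"
  shows "card A = (\<Sum>v\<in>I. card {a \<in> A. f a = v})"
  using sum.group[OF assms, of "\<lambda>_. 1::nat"] by simp

context configuration_model
begin

text \<open>As an image, this collapses repeated edges; only where \<open>j\<close> determines its
  cell set are there as many edges as parts.\<close>

definition edges :: "('p \<Rightarrow> 'p) \<Rightarrow> 'v set set" where
  "edges \<sigma> = (\<lambda>j. cell ` {p \<in> P. part (\<sigma> p) = j}) ` (part ` P)"

lemma card_P_parts: "card P = card (part ` P) * r"
proof -
  have "card P = (\<Sum>j\<in>part ` P. card {p \<in> P. part p = j})"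
    using finite_P by (intro card_eq_sum_fibres) auto
  also have "\<dots> = (\<Sum>j\<in>part ` P. r)" using card_part by (intro sum.cong) auto
  finally show ?thesis by simp
qed

lemma
  assumes "\<sigma> \<in> simple_cfgs"
  shows simple_perm: "\<sigma> permutes P"
    and simple_no_loop: "\<lbrakk>x \<in> P; y \<in> P; cell x = cell y; part (\<sigma> x) = part (\<sigma> y)\<rbrakk> \<Longrightarrow> x = y"
    and simple_no_repeat: "inj_on (\<lambda>j. cell ` {p \<in> P. part (\<sigma> p) = j}) (part ` P)"
proof -
  have *: "\<sigma> \<in> cfgs mates {}" "\<not> repeated \<sigma>" using assms by (auto simp: simple_cfgs_def)
  show perm: "\<sigma> permutes P" using * by (simp add: cfgs_def)
  show "x = y" if "x \<in> P" "y \<in> P" "cell x = cell y" "part (\<sigma> x) = part (\<sigma> y)" for x y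
  proof (rule ccontr)
    assume "x \<noteq> y"
    then have "(x, y) \<in> mates" using that by (simp add: mates_def)
    then show False using * that by (auto simp: cfgs_def together_def)
  qed
  show "inj_on (\<lambda>j. cell ` {p \<in> P. part (\<sigma> p) = j}) (part ` P)"
  proof (rule inj_onI, rule ccontr)
    fix i j assume ij: "i \<in> part ` P" "j \<in> part ` P" "i \<noteq> j"
      "cell ` {p \<in> P. part (\<sigma> p) = i} = cell ` {p \<in> P. part (\<sigma> p) = j}"
    \<comment> \<open>Since \<open>\<sigma>\<close> maps \<open>P\<close> onto itself, every part is
      the part of \<open>\<sigma> x\<close> for some point \<open>x\<close>, which turns labels into
      the points used in \<open>repeated\<close>.\<close>
    have "part ` P = (\<lambda>p. part (\<sigma> p)) ` P"
      using permutes_image[OF perm] by (metis image_image)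
    then obtain x y where xy: "x \<in> P" "y \<in> P" "i = part (\<sigma> x)" "j = part (\<sigma> y)" using ij(1,2) by auto
    then have "repeated \<sigma>" 
      unfolding repeated_def using ij(3,4) by (intro bexI[of _ x] bexI[of _ y]) (auto simp: together_def eq_commute)
    then show False using * by simp
  qed
qed

lemma part_fibre: 
  assumes "\<sigma> permutes P" "j \<in> part ` P"
  shows "card {p \<in> P. part (\<sigma> p) = j} = r"
proof -
  have "part ` P = (\<lambda>p. part (\<sigma> p)) ` P"
    using permutes_image[OF assms(1)] by (metis image_image)
  then obtain x where x: "x \<in> P" "j = part (\<sigma> x)" using assms(2) by auto
  then show "card {p \<in> P. part (\<sigma> p) = j} = r"
    using card_block[OF assms(1) x(1)] by (simp add: together_def eq_commute)
qed

text \<open>Each point of the cell \<open>v\<close> contributes the edge of its part. Two such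
  points give different edges: no repeated edge puts them in a common part otherwise, and no loop
  forbids that.\<close>

lemma edges_simple_cfgs:
  assumes \<sigma>: "\<sigma> \<in> simple_cfgs" and V: "cell ` P \<subseteq> V"
  shows "simple_uniform_hypergraph r V (edges \<sigma>)" "hdegree (edges \<sigma>) v = card {p \<in> P. cell p = v}"
proof -
  let ?g = "\<lambda>j. cell ` {p \<in> P. part (\<sigma> p) = j}"
  note perm = simple_perm[OF \<sigma>]
  have "card (?g j) = r" if "j \<in> part ` P" for j
  proof -
    have "inj_on cell {p \<in> P. part (\<sigma> p) = j}" using simple_no_loop[OF \<sigma>] by (intro inj_onI) auto
    then show ?thesis using part_fibre[OF perm that] by (simp add: card_image)
  qed
  then show "simple_uniform_hypergraph r V (edges \<sigma>)"
    using V by (auto simp: simple_uniform_hypergraph_def edges_def)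
  have "bij_betw (\<lambda>p. ?g (part (\<sigma> p))) {p \<in> P. cell p = v} {e \<in> edges \<sigma>. v \<in> e}"
  proof (rule bij_betw_imageI)
    have inP: "part (\<sigma> p) \<in> part ` P" if "p \<in> P" for p using permutes_in_image[OF perm] that by blast
    show "inj_on (\<lambda>p. ?g (part (\<sigma> p))) {p \<in> P. cell p = v}"
    proof (rule inj_onI)
      fix p q assume pq: "p \<in> {p \<in> P. cell p = v}" "q \<in> {p \<in> P. cell p = v}" "?g (part (\<sigma> p)) = ?g (part (\<sigma> q))"
      then have "part (\<sigma> p) = part (\<sigma> q)" using inj_onD[OF simple_no_repeat[OF \<sigma>] pq(3)] inP by blast
      then show "p = q" using simple_no_loop[OF \<sigma>] pq by auto
    qed
    show "(\<lambda>p. ?g (part (\<sigma> p))) ` {p \<in> P. cell p = v} = {e \<in> edges \<sigma>. v \<in> e}"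
    proof (intro equalityI subsetI)
      fix e assume "e \<in> (\<lambda>p. ?g (part (\<sigma> p))) ` {p \<in> P. cell p = v}"
      then show "e \<in> {e \<in> edges \<sigma>. v \<in> e}" using inP by (auto simp: edges_def)
    next
      fix e assume "e \<in> {e \<in> edges \<sigma>. v \<in> e}"
      then obtain j p where "e = ?g j" "p \<in> P" "part (\<sigma> p) = j" "v = cell p" by (auto simp: edges_def)
      then show "e \<in> (\<lambda>p. ?g (part (\<sigma> p))) ` {p \<in> P. cell p = v}" by auto
    qed
  qed
  then show "hdegree (edges \<sigma>) v = card {p \<in> P. cell p = v}"
    unfolding hdegree_def by (rule bij_betw_same_card[symmetric])
qed

text \<open>A matching that realises \<open>E\<close> factors uniquely through the vertex-edge
  incidences of \<open>E\<close>. Labelling edges by parts gives the first factorial, assigning the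
  slots of each part to the incidences of its edge gives the powers of \<open>fact r\<close>, and
  assigning the points of each cell to the incidences at its vertex gives the product over the
  vertices.\<close>

lemma card_edges_fibre:
  assumes V: "finite V" "cell ` P \<subseteq> V" and E: "simple_uniform_hypergraph r V E"
    and deg: "\<And>v. v \<in> V \<Longrightarrow> hdegree E v = card {p \<in> P. cell p = v}"
  shows "card {\<sigma> \<in> simple_cfgs. edges \<sigma> = E}
    = fact (card (part ` P)) * fact r ^ card (part ` P) * (\<Prod>v\<in>V. fact (hdegree E v))"
proof -
  define J where "J = part ` P"
  have finJ: "finite J" using finite_P by (simp add: J_def)
  have Esub: "E \<subseteq> Pow V" and Er: "\<And>e. e \<in> E \<Longrightarrow> card e = r" and EV: "\<And>e. e \<in> E \<Longrightarrow> e \<subseteq> V" 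
    using E by (auto simp: simple_uniform_hypergraph_def)
  have finE: "finite E" using Esub V by (meson finite_Pow_iff finite_subset)
  define I where "I = {(v, e). e \<in> E \<and> v \<in> e}"
  have finI: "finite I" by (rule finite_subset[of _ "V \<times> E"]) (use V finE EV in \<open>auto simp: I_def\<close>)
  have I_snd: "card {i \<in> I. snd i = e} = r" if "e \<in> E" for e
  proof -
    have "{i \<in> I. snd i = e} = (\<lambda>v. (v, e)) ` e" using that by (auto simp: I_def)
    then show ?thesis using Er[OF that] by (simp add: card_image inj_on_def)
  qed
  have I_fst: "card {i \<in> I. fst i = v} = card {p \<in> P. cell p = v}" if "v \<in> V" for v
  proof -
    have "{i \<in> I. fst i = v} = Pair v ` {e \<in> E. v \<in> e}" by (auto simp: I_def)
    then have "card {i \<in> I. fst i = v} = card {e \<in> E. v \<in> e}" by (simp add: card_image inj_on_def)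
    also have "\<dots> = card {p \<in> P. cell p = v}" using deg[OF that] by (simp add: hdegree_def)
    finally show ?thesis .
  qed
  have IP: "card I = card P"
  proof -
    have "card I = (\<Sum>v\<in>V. card {i \<in> I. fst i = v})"
      using V finI by (intro card_eq_sum_fibres) (auto simp: I_def dest: EV[THEN subsetD])
    also have "\<dots> = (\<Sum>v\<in>V. card {p \<in> P. cell p = v})" by (rule sum.cong[OF refl I_fst])
    also have "\<dots> = card P" using V finite_P by (intro card_eq_sum_fibres[symmetric]) auto
    finally show ?thesis .
  qed
  have EJ: "card E = card J"
  proof -
    have "card I = (\<Sum>e\<in>E. card {i \<in> I. snd i = e})"
      using finE finI by (intro card_eq_sum_fibres) (auto simp: I_def)
    also have "\<dots> = card E * r" using I_snd by simp
    finally show ?thesis using IP card_P_parts r_ge_3 by (simp add: J_def)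
  qed
  define H where "H = {h \<in> E \<rightarrow>\<^sub>E J. inj_on h E}"
  define A where "A = colour_bijs P cell I fst"
  define B where "B h = colour_bijs I (h \<circ> snd) P part" for h :: "'v set \<Rightarrow> 'j"
  \<comment> \<open>\<open>h\<close> labels the edges by parts, \<open>\<alpha>\<close> sends points to incidences, \<open>\<beta>\<close> sends incidences to slots\<close>
  define \<Psi> where "\<Psi> = (\<lambda>(h :: 'v set \<Rightarrow> 'j, \<alpha> :: 'p \<Rightarrow> 'v \<times> 'v set, \<beta> :: 'v \<times> 'v set \<Rightarrow> 'p). \<lambda>p. if p \<in> P then \<beta> (\<alpha> p) else p)"
  have cardH: "card H = fact (card J)" unfolding H_def using finE finJ EJ by (simp add: card_inj_on_same_card)
  have cardA: "card A = (\<Prod>v\<in>V. fact (hdegree E v))"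
    unfolding A_def using finite_P finI V I_fst IP deg by (subst card_colour_bijs[where I = V]) auto
  have h_img: "h ` E = J" if "h \<in> H" for h
    using that finJ EJ by (intro card_subset_eq) (auto simp: H_def card_image)
  have cardB: "card (B h) = fact r ^ card J" if h: "h \<in> H" for h
  proof -
    have hinj: "inj_on h E" using h by (simp add: H_def)
    have fib: "card {i \<in> I. (h \<circ> snd) i = j} = r" "card {p \<in> P. part p = j} = r" if j: "j \<in> J" for j
    proof -
      obtain e where e: "e \<in> E" "j = h e" using h_img[OF h] j by auto
      have "{i \<in> I. (h \<circ> snd) i = j} = {i \<in> I. snd i = e}"
        using e hinj by (auto simp: I_def dest: inj_onD)
      then show "card {i \<in> I. (h \<circ> snd) i = j} = r" using I_snd[OF e(1)] by simp
      show "card {p \<in> P. part p = j} = r" using j card_part by (auto simp: J_def)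
    qed
    have "card (B h) = (\<Prod>j\<in>J. fact (card {i \<in> I. (h \<circ> snd) i = j}))"
      unfolding B_def using finite_P finI finJ fib IP h
      by (intro card_colour_bijs) (auto simp: I_def H_def)
    also have "\<dots> = fact r ^ card J" using fib by simp
    finally show ?thesis .
  qed
  \<comment> \<open>The last conjunct is kept for injectivity: it shows that the part labelled
    \<open>h e\<close> determines \<open>e\<close>, so \<open>h\<close> can be read off from the
    matching.\<close>
  have main: "\<Psi> (h, \<alpha>, \<beta>) \<in> simple_cfgs \<and> edges (\<Psi> (h, \<alpha>, \<beta>)) = E 
      \<and> (\<forall>e\<in>E. cell ` {p \<in> P. part (\<Psi> (h, \<alpha>, \<beta>) p) = h e} = e)"
    if h: "h \<in> H" and \<alpha>: "\<alpha> \<in> A" and \<beta>: "\<beta> \<in> B h" for h \<alpha> \<beta>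
  proof -
    let ?\<sigma> = "\<Psi> (h, \<alpha>, \<beta>)"
    have hinj: "inj_on h E" using h by (simp add: H_def)
    have a: "bij_betw \<alpha> P I" "\<And>p. p \<in> P \<Longrightarrow> fst (\<alpha> p) = cell p" using \<alpha> by (auto simp: A_def colour_bijs_def)
    have b: "bij_betw \<beta> I P" "\<And>i. i \<in> I \<Longrightarrow> part (\<beta> i) = h (snd i)" using \<beta> by (auto simp: B_def colour_bijs_def)
    have aI: "\<alpha> p \<in> I" if "p \<in> P" for p using a(1) that by (auto simp: bij_betw_def)
    have sE: "snd (\<alpha> p) \<in> E" if "p \<in> P" for p using aI[OF that] by (auto simp: I_def)
    have ps: "part (?\<sigma> p) = h (snd (\<alpha> p))" if "p \<in> P" for p using that b(2) aI by (simp add: \<Psi>_def)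
    have "bij_betw (\<beta> \<circ> \<alpha>) P P" using a(1) b(1) by (rule bij_betw_trans)
    then have "bij_betw ?\<sigma> P P" by (rule bij_betw_cong[THEN iffD1, rotated]) (simp add: \<Psi>_def)
    then have perm: "?\<sigma> permutes P" by (rule bij_imp_permutes) (simp add: \<Psi>_def)
    have fibre: "{p \<in> P. part (?\<sigma> p) = h e} = {p \<in> P. snd (\<alpha> p) = e}" if "e \<in> E" for e
      using ps sE that inj_on_eq_iff[OF hinj] by auto
    have cells: "cell ` {p \<in> P. part (?\<sigma> p) = h e} = e" if e: "e \<in> E" for e
    proof -
      have "cell ` {p \<in> P. snd (\<alpha> p) = e} = fst ` {i \<in> I. snd i = e}"
      proof -
        have "{i \<in> I. snd i = e} = \<alpha> ` {p \<in> P. snd (\<alpha> p) = e}" using a(1) by (auto simp: bij_betw_def)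
        then have "fst ` {i \<in> I. snd i = e} = (\<lambda>p. fst (\<alpha> p)) ` {p \<in> P. snd (\<alpha> p) = e}" by (simp add: image_image)
        also have "\<dots> = cell ` {p \<in> P. snd (\<alpha> p) = e}" using a(2) by (intro image_cong) auto
        finally show ?thesis by simp
      qed
      also have "\<dots> = e" using e by (force simp: I_def)
      finally show ?thesis using fibre[OF e] by simp
    qed
    have "edges ?\<sigma> = (\<lambda>j. cell ` {p \<in> P. part (?\<sigma> p) = j}) ` h ` E"
      using h_img[OF h] by (simp add: edges_def J_def)
    also have "\<dots> = E" using cells by (simp add: image_image)
    finally have ed: "edges ?\<sigma> = E" .
    \<comment> \<open>Two cellmates in one part would have the same vertex and the same edge, hence
      the same incidence under the injective \<open>\<alpha>\<close>.\<close>
    have "\<not> together ?\<sigma> x y" if "(x, y) \<in> mates" for x y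
    proof
      assume t: "together ?\<sigma> x y"
      have xy: "x \<in> P" "y \<in> P" "cell x = cell y" "x \<noteq> y" using that by (auto simp: mates_def)
      have "h (snd (\<alpha> x)) = h (snd (\<alpha> y))" using t ps xy by (simp add: together_def)
      then have "snd (\<alpha> x) = snd (\<alpha> y)" using hinj sE xy by (auto dest: inj_onD)
      moreover have "fst (\<alpha> x) = fst (\<alpha> y)" using a(2) xy by simp
      ultimately have "\<alpha> x = \<alpha> y" by (simp add: prod_eq_iff)
      then show False using a(1) xy by (auto simp: bij_betw_def dest: inj_onD)
    qed
    moreover have "\<not> repeated ?\<sigma>"
    proof
      assume "repeated ?\<sigma>"
      then obtain x y where xy: "x \<in> P" "y \<in> P" "\<not> together ?\<sigma> x y"
        "cell ` {d \<in> P. together ?\<sigma> x d} = cell ` {d \<in> P. together ?\<sigma> y d}" by (auto simp: repeated_def)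
      have bl: "{d \<in> P. together ?\<sigma> z d} = {p \<in> P. part (?\<sigma> p) = h (snd (\<alpha> z))}" if "z \<in> P" for z
        using ps that by (auto simp: together_def)
      have "snd (\<alpha> x) = snd (\<alpha> y)" using xy(4) unfolding bl[OF xy(1)] bl[OF xy(2)] cells[OF sE[OF xy(1)]] cells[OF sE[OF xy(2)]] .
      then show False using xy(1-3) ps by (simp add: together_def)
    qed
    ultimately show ?thesis using perm ed cells by (auto simp: simple_cfgs_def cfgs_def)
  qed
  have "bij_betw \<Psi> (SIGMA h:H. A \<times> B h) {\<sigma> \<in> simple_cfgs. edges \<sigma> = E}"
  proof (rule bij_betw_imageI)
    show "inj_on \<Psi> (SIGMA h:H. A \<times> B h)"
    proof (rule inj_onI)
      fix z z' assume z: "z \<in> (SIGMA h:H. A \<times> B h)" and z': "z' \<in> (SIGMA h:H. A \<times> B h)" and zz: "\<Psi> z = \<Psi> z'"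
      obtain h \<alpha> \<beta> where zdef: "z = (h, \<alpha>, \<beta>)" by (metis surj_pair)
      obtain h' \<alpha>' \<beta>' where zdef': "z' = (h', \<alpha>', \<beta>')" by (metis surj_pair)
      have h: "h \<in> H" and \<alpha>: "\<alpha> \<in> A" and \<beta>: "\<beta> \<in> B h" using z unfolding zdef by simp_all
      have h': "h' \<in> H" and \<alpha>': "\<alpha>' \<in> A" and \<beta>': "\<beta>' \<in> B h'" using z' unfolding zdef' by simp_all
      have eq: "\<Psi> (h, \<alpha>, \<beta>) = \<Psi> (h', \<alpha>', \<beta>')" using zz unfolding zdef zdef' .
      let ?\<sigma> = "\<Psi> (h, \<alpha>, \<beta>)"
      have c: "cell ` {p \<in> P. part (?\<sigma> p) = h e} = e" "cell ` {p \<in> P. part (?\<sigma> p) = h' e} = e" if "e \<in> E" for e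
        using main[OF h \<alpha> \<beta>] main[OF h' \<alpha>' \<beta>'] eq that by auto
      have hh: "h = h'"
      proof (rule PiE_ext)
        show "h \<in> E \<rightarrow>\<^sub>E J" "h' \<in> E \<rightarrow>\<^sub>E J" using h h' by (auto simp: H_def)
        fix e assume e: "e \<in> E"
        then have "h e \<in> h' ` E" using h_img[OF h] h_img[OF h'] by blast
        then obtain e' where e': "e' \<in> E" "h e = h' e'" by auto
        then have "e = e'" using c(1)[OF e] c(2)[OF e'(1)] by simp
        then show "h e = h' e" using e' by simp
      qed
      have hinj: "inj_on h E" using h by (simp add: H_def)
      have p1: "part (?\<sigma> p) = h (snd (\<alpha> p))" "\<alpha> p \<in> I" "fst (\<alpha> p) = cell p" if "p \<in> P" for p
        using \<alpha> \<beta> that by (auto simp: A_def B_def colour_bijs_def \<Psi>_def PiE_def Pi_def)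
      have p2: "part (?\<sigma> p) = h (snd (\<alpha>' p))" "\<alpha>' p \<in> I" "fst (\<alpha>' p) = cell p" if "p \<in> P" for p
        unfolding eq using \<alpha>' \<beta>' that hh by (auto simp: A_def B_def colour_bijs_def \<Psi>_def PiE_def Pi_def)
      \<comment> \<open>The incidence \<open>\<alpha> p\<close> consists of \<open>cell p\<close>
        and the edge whose label is the part of \<open>p\<close>, so the matching and
        \<open>h\<close> determine it.\<close>
      have aa: "\<alpha> = \<alpha>'"
      proof (rule PiE_ext)
        show "\<alpha> \<in> P \<rightarrow>\<^sub>E I" "\<alpha>' \<in> P \<rightarrow>\<^sub>E I" using \<alpha> \<alpha>' by (auto simp: A_def colour_bijs_def)
        fix p assume p: "p \<in> P"
        have "snd (\<alpha> p) \<in> E" "snd (\<alpha>' p) \<in> E" using p1(2)[OF p] p2(2)[OF p] by (auto simp: I_def)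
        moreover have "h (snd (\<alpha> p)) = h (snd (\<alpha>' p))" using p1(1)[OF p] p2(1)[OF p] by simp
        ultimately have "snd (\<alpha> p) = snd (\<alpha>' p)" using hinj by (auto dest: inj_onD)
        then show "\<alpha> p = \<alpha>' p" using p1(3)[OF p] p2(3)[OF p] by (simp add: prod_eq_iff)
      qed
      have "\<beta> = \<beta>'"
      proof (rule PiE_ext)
        show "\<beta> \<in> I \<rightarrow>\<^sub>E P" "\<beta>' \<in> I \<rightarrow>\<^sub>E P" using \<beta> \<beta>' by (auto simp: B_def colour_bijs_def)
        fix i assume "i \<in> I"
        moreover have "\<alpha> ` P = I" using \<alpha> by (auto simp: A_def colour_bijs_def bij_betw_def)
        ultimately obtain p where p: "p \<in> P" "i = \<alpha> p" by auto
        then show "\<beta> i = \<beta>' i" using fun_cong[OF eq, of p] aa by (simp add: \<Psi>_def)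
      qed
      with hh aa show "z = z'" unfolding zdef zdef' by simp
    qed
    show "\<Psi> ` (SIGMA h:H. A \<times> B h) = {\<sigma> \<in> simple_cfgs. edges \<sigma> = E}"
    proof (intro equalityI subsetI)
      fix \<sigma> assume "\<sigma> \<in> \<Psi> ` (SIGMA h:H. A \<times> B h)"
      then obtain z where z: "z \<in> (SIGMA h:H. A \<times> B h)" and \<sigma>: "\<sigma> = \<Psi> z" by (rule imageE)
      obtain h \<alpha> \<beta> where zdef: "z = (h, \<alpha>, \<beta>)" by (metis surj_pair)
      have "h \<in> H" "\<alpha> \<in> A" "\<beta> \<in> B h" using z unfolding zdef by simp_all
      with \<sigma> zdef show "\<sigma> \<in> {\<sigma> \<in> simple_cfgs. edges \<sigma> = E}" using main[of h \<alpha> \<beta>] by blast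
    next
      fix \<sigma> assume "\<sigma> \<in> {\<sigma> \<in> simple_cfgs. edges \<sigma> = E}"
      then have \<sigma>: "\<sigma> \<in> simple_cfgs" and ed: "edges \<sigma> = E" by auto
      note perm = simple_perm[OF \<sigma>]
      \<comment> \<open>Surjectivity: \<open>g\<close> reads the edge in each part, \<open>h\<close>
        is its inverse, \<open>\<alpha>\<close> sends a point to its cell and its edge, and
        \<open>\<beta>\<close> is \<open>\<sigma>\<close> after the inverse of
        \<open>\<alpha>\<close>.\<close>
      define g where "g j = cell ` {p \<in> P. part (\<sigma> p) = j}" for j
      have ginj: "inj_on g J" using simple_no_repeat[OF \<sigma>] by (simp add: g_def[abs_def] J_def)
      have gE: "g ` J = E" using ed by (simp add: g_def[abs_def] J_def edges_def)
      define h where "h = restrict (inv_into J g) E"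
      have hg: "h (g j) = j" if "j \<in> J" for j using that ginj gE by (auto simp: h_def)
      have hH: "h \<in> H"
        using gE by (auto simp: H_def h_def inv_into_into intro!: inj_onI dest: inv_into_injective)
      have pJ: "part (\<sigma> p) \<in> J" if "p \<in> P" for p using permutes_in_image[OF perm] that by (auto simp: J_def)
      define \<alpha> where "\<alpha> = (\<lambda>p\<in>P. (cell p, g (part (\<sigma> p))))"
      have aI: "\<alpha> ` P \<subseteq> I"
        using pJ gE by (auto simp: \<alpha>_def I_def) (auto simp: g_def)
      have ainj: "inj_on \<alpha> P"
      proof (rule inj_onI)
        fix p q assume pq: "p \<in> P" "q \<in> P" "\<alpha> p = \<alpha> q"
        then have "part (\<sigma> p) = part (\<sigma> q)" using ginj pJ by (auto simp: \<alpha>_def dest: inj_onD)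
        then show "p = q" using simple_no_loop[OF \<sigma>] pq by (auto simp: \<alpha>_def)
      qed
      have aimg: "\<alpha> ` P = I" using aI finI IP ainj by (intro card_subset_eq) (auto simp: card_image)
      have \<alpha>A: "\<alpha> \<in> A" using aI ainj aimg by (auto simp: A_def colour_bijs_def bij_betw_def \<alpha>_def)
      define \<beta> where "\<beta> = (\<lambda>i\<in>I. \<sigma> (inv_into P \<alpha> i))"
      have \<beta>\<alpha>: "\<beta> (\<alpha> p) = \<sigma> p" if "p \<in> P" for p
        using that ainj aI by (auto simp: \<beta>_def)
      have "bij_betw (\<lambda>i. \<sigma> (inv_into P \<alpha> i)) I P"
      proof -
        have "bij_betw (inv_into P \<alpha>) I P" by (rule bij_betw_inv_into) (simp add: bij_betw_def ainj aimg)
        from bij_betw_trans[OF this permutes_imp_bij[OF perm]] show ?thesis by (simp add: comp_def)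
      qed
      then have bb: "bij_betw \<beta> I P" by (rule bij_betw_cong[THEN iffD1, rotated]) (simp add: \<beta>_def)
      have "part (\<beta> i) = h (snd i)" if i: "i \<in> I" for i
      proof -
        obtain p where p: "p \<in> P" "i = \<alpha> p" using i aimg by auto
        then have "part (\<beta> i) = part (\<sigma> p)" using \<beta>\<alpha> by simp
        also have "\<dots> = h (g (part (\<sigma> p)))" using hg pJ p by simp
        also have "g (part (\<sigma> p)) = snd i" using p by (simp add: \<alpha>_def)
        finally show ?thesis .
      qed
      then have "\<beta> \<in> B h" using bb by (auto simp: B_def colour_bijs_def \<beta>_def bij_betw_def)
      moreover have "\<sigma> = \<Psi> (h, \<alpha>, \<beta>)"
        using \<beta>\<alpha> permutes_not_in[OF perm] by (auto simp: \<Psi>_def)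
      ultimately show "\<sigma> \<in> \<Psi> ` (SIGMA h:H. A \<times> B h)" using hH \<alpha>A by (intro image_eqI[of _ _ "(h, \<alpha>, \<beta>)"]) auto
    qed
  qed
  then have "card {\<sigma> \<in> simple_cfgs. edges \<sigma> = E} = card (SIGMA h:H. A \<times> B h)"
    by (rule bij_betw_same_card[symmetric])
  also have "\<dots> = (\<Sum>h\<in>H. card (A \<times> B h))"
  proof (rule card_SigmaI)
    \<comment> \<open>An infinite set has cardinality 0, so the positive value just computed yields
      finiteness.\<close>
    show "finite H" by (rule card_ge_0_finite) (simp add: cardH)
    show "\<forall>h\<in>H. finite (A \<times> B h)"
    proof
      fix h assume h: "h \<in> H"
      have "finite A" by (rule card_ge_0_finite) (simp only: cardA, intro prod_pos, simp)
      moreover have "finite (B h)" by (rule card_ge_0_finite) (simp add: cardB[OF h])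
      ultimately show "finite (A \<times> B h)" by simp
    qed
  qed
  also have "\<dots> = (\<Sum>h\<in>H. card A * fact r ^ card J)" using cardB by (simp add: card_cartesian_product)
  finally show ?thesis by (simp add: cardH cardA J_def algebra_simps)
qed

text \<open>The fibre of \<open>edges\<close> over a hypergraph has a size that depends only on the
  degrees, so all fibres are equally large.\<close>

lemma card_simple_cfgs_eq:
  assumes V: "finite V" "cell ` P \<subseteq> V" and k: "\<And>v. v \<in> V \<Longrightarrow> card {p \<in> P. cell p = v} = k v"
  shows "card simple_cfgs = card {E. simple_uniform_hypergraph r V E \<and> (\<forall>v\<in>V. hdegree E v = k v)}
    * (fact (card (part ` P)) * fact r ^ card (part ` P) * (\<Prod>v\<in>V. fact (k v)))"
proof -
  let ?H = "{E. simple_uniform_hypergraph r V E \<and> (\<forall>v\<in>V. hdegree E v = k v)}"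
  have "finite ?H"
    by (rule finite_subset[of _ "Pow (Pow V)"]) (use V in \<open>auto simp: simple_uniform_hypergraph_def\<close>)
  moreover have "finite simple_cfgs" by (simp add: simple_cfgs_def)
  moreover have "edges ` simple_cfgs \<subseteq> ?H" using edges_simple_cfgs[OF _ V(2)] k by auto
  ultimately have "card simple_cfgs = (\<Sum>E\<in>?H. card {\<sigma> \<in> simple_cfgs. edges \<sigma> = E})"
    by (intro card_eq_sum_fibres)
  also have "\<dots> = (\<Sum>E\<in>?H. fact (card (part ` P)) * fact r ^ card (part ` P) * (\<Prod>v\<in>V. fact (k v)))"
    using k by (intro sum.cong refl) (auto simp: card_edges_fibre[OF V])
  finally show ?thesis by simp
qed

end

context configuration_model
begin

lemma card_mates_eq:
  assumes V: "finite V" "cell ` P \<subseteq> V" and k: "\<And>v. v \<in> V \<Longrightarrow> card {p \<in> P. cell p = v} = k v"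
  shows "card mates = (\<Sum>v\<in>V. falling (k v) 2)"
proof -
  have "mates = (SIGMA x:P. {y \<in> P. cell y = cell x} - {x})" by (auto simp: mates_def)
  then have "card mates = (\<Sum>x\<in>P. card ({y \<in> P. cell y = cell x} - {x}))" using finite_P by simp
  also have "\<dots> = (\<Sum>x\<in>P. k (cell x) - 1)" using V k by (intro sum.cong refl) (auto simp: card_Diff_singleton)
  also have "\<dots> = (\<Sum>v\<in>V. \<Sum>x\<in>{x \<in> P. cell x = v}. k (cell x) - 1)"
    by (rule sum.group[OF finite_P V, symmetric])
  also have "\<dots> = (\<Sum>v\<in>V. k v * (k v - 1))" using k by (intro sum.cong refl) simp
  also have "\<dots> = (\<Sum>v\<in>V. falling (k v) 2)" by (simp add: falling_def numeral_2_eq_2)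
  finally show ?thesis .
qed

end

section \<open>Counting hypergraphs with given degrees\<close>

lemma card_div_fibre:
  fixes p r :: nat
  assumes "p < m * r"
  shows "card {q \<in> {..<m * r}. q div r = p div r} = r"
proof -
  have r: "r > 0" using assms by (cases r) auto
  have "{q \<in> {..<m * r}. q div r = p div r} = {p div r * r ..< p div r * r + r}"
  proof (intro equalityI subsetI)
    fix q assume "q \<in> {q \<in> {..<m * r}. q div r = p div r}"
    then show "q \<in> {p div r * r ..< p div r * r + r}"
      using div_mult_mod_eq[of q r] mod_less_divisor[OF r, of q] by auto
  next
    fix q assume q: "q \<in> {p div r * r ..< p div r * r + r}"
    then have d: "q div r = p div r" by (intro div_nat_eqI) (auto simp: mult.commute)
    moreover have "p div r < m" using assms r by (simp add: less_mult_imp_div_less)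
    then have "q < m * r" using d div_less_iff_less_mult[OF r, of q m] by simp
    ultimately show "q \<in> {q \<in> {..<m * r}. q div r = p div r}" by simp
  qed
  then show ?thesis by simp
qed

lemma div_image: "0 < r \<Longrightarrow> (\<lambda>q. q div r) ` {..<m * r} = {..<m}" for r :: nat
proof (intro equalityI subsetI)
  fix j assume "0 < r" "j \<in> {..<m}"
  then show "j \<in> (\<lambda>q. q div r) ` {..<m * r}" by (intro image_eqI[of _ _ "j * r"]) auto
qed (auto simp: less_mult_imp_div_less)

text \<open>Supplies the cells of a concrete model: the points are an enumeration of the pairs of a
  vertex \<open>v\<close> and a number below \<open>k v\<close>.\<close>

lemma exists_fibre_sizes:
  fixes k :: "'a \<Rightarrow> nat"
  assumes "finite V"
  obtains c :: "nat \<Rightarrow> 'a" where "c ` {..<sum k V} \<subseteq> V" "\<And>v. v \<in> V \<Longrightarrow> card {p \<in> {..<sum k V}. c p = v} = k v"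
proof -
  let ?S = "SIGMA v:V. {..<k v}"
  have "card ?S = sum k V" "finite ?S" using assms by auto
  then obtain h where h: "bij_betw h {..<sum k V} ?S"
    by (metis ex_bij_betw_nat_finite atLeast0LessThan)
  show ?thesis
  proof (rule that[of "fst \<circ> h"])
    have "(fst \<circ> h) ` {..<sum k V} = fst ` ?S" using h by (metis bij_betw_imp_surj_on image_comp)
    then show "(fst \<circ> h) ` {..<sum k V} \<subseteq> V" by auto
    fix v assume v: "v \<in> V"
    have "bij_betw h {p \<in> {..<sum k V}. (fst \<circ> h) p = v} {z \<in> ?S. fst z = v}"
    proof (rule bij_betw_subset[OF h])
      have "h ` {p \<in> {..<sum k V}. (fst \<circ> h) p = v} = {z \<in> h ` {..<sum k V}. fst z = v}" by auto
      then show "h ` {p \<in> {..<sum k V}. (fst \<circ> h) p = v} = {z \<in> ?S. fst z = v}"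
        unfolding bij_betw_imp_surj_on[OF h] .
    qed auto
    then have "card {p \<in> {..<sum k V}. (fst \<circ> h) p = v} = card {z \<in> ?S. fst z = v}" by (rule bij_betw_same_card)
    also have "{z \<in> ?S. fst z = v} = Pair v ` {..<k v}" using v by auto
    also have "card \<dots> = k v" by (simp add: card_image inj_on_def)
    finally show "card {p \<in> {..<sum k V}. (fst \<circ> h) p = v} = k v" .
  qed
qed

text \<open>All matchings divided by the number of matchings per simple hypergraph: the leading
  factor of the asymptotic formula.\<close>

definition configuration_ratio :: "nat \<Rightarrow> nat \<Rightarrow> (nat \<Rightarrow> nat) \<Rightarrow> real" where
  "configuration_ratio r n k = fact (M n k)
     / (fact (M n k div r) * fact r ^ (M n k div r) * (\<Prod>i=1..n. fact (k i)))"

lemma configuration_ratio_pos: "configuration_ratio r n k > 0"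
  unfolding configuration_ratio_def by (intro divide_pos_pos mult_pos_pos prod_pos zero_less_power) auto

lemma finite_hypergraphs [simp]: "finite (hypergraphs r n k)"
  by (rule finite_subset[of _ "Pow (Pow {1..n})"])
    (auto simp: hypergraphs_def simple_uniform_hypergraph_def)

lemma sparse_bounds:
  fixes r K m :: real
  assumes r: "r \<ge> 3" and K: "K \<ge> 1"
  shows "r * K \<le> r ^ 4 * K ^ 3" "r ^ 2 * K \<le> r ^ 4 * K ^ 3" "3 \<le> r * K" "r \<le> r * K"
proof -
  have "r ^ 1 * K ^ 1 \<le> r ^ 4 * K ^ 3" "r ^ 2 * K ^ 1 \<le> r ^ 4 * K ^ 3"
    using r K by (intro mult_mono power_increasing; simp)+
  then show "r * K \<le> r ^ 4 * K ^ 3" "r ^ 2 * K \<le> r ^ 4 * K ^ 3" by simp_all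
  show "3 \<le> r * K" using mult_mono[of 3 r 1 K] r K by simp
  show "r \<le> r * K" using mult_left_mono[of 1 K r] r K by simp
qed

text \<open>The model is instantiated with the numbers below \<open>M n k\<close>, parts being runs
  of \<open>r\<close> consecutive numbers. \<open>K\<close> is any upper bound for the degrees
  rather than their maximum, so that the same \<open>K\<close> serves after an edge has been
  deleted.\<close>

lemma card_hypergraphs_estimate:
  assumes r: "r \<ge> 3" and dvd: "r dvd M n k" and K: "K \<ge> 1" "\<And>i. i \<in> {1..n} \<Longrightarrow> k i \<le> K"
    and large: "32 * real r ^ 4 * real K ^ 3 \<le> real (M n k)"
  shows "card (hypergraphs r n k) > 0"
    "\<bar>ln (real (card (hypergraphs r n k)) / configuration_ratio r n k)
       + (real r - 1) * real (M2 n k) / (2 * real (M n k))\<bar> \<le> 40 * real r ^ 4 * real K ^ 3 / real (M n k)"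
proof -
  obtain m where m: "M n k = m * r" using dvd by (metis dvd_def mult.commute)
  obtain cell where cell: "cell ` {..<M n k} \<subseteq> {1..n}"
     "\<And>v. v \<in> {1..n} \<Longrightarrow> card {p \<in> {..<M n k}. cell p = v} = k v"
    using exists_fibre_sizes[of "{1..n}" k] unfolding M_def by auto
  define P where "P = {..<M n k}"
  define part where "part = (\<lambda>q. q div r)"
  have cP: "card P = M n k" by (simp add: P_def)
  have rK: "real r \<ge> 3" "real K \<ge> 1" using r K by simp_all
  have "4 * real K * real r + 12 \<le> 32 * real r ^ 4 * real K ^ 3"
  proof -
    have "4 * (real r * real K) + 12 \<le> 32 * (real r ^ 4 * real K ^ 3)"
      using sparse_bounds[OF rK] by linarith
    then show ?thesis by (simp add: ac_simps)
  qed
  then have "real (4 * K * r + 12) \<le> real (card P)" using large cP by simp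
  then have sp: "4 * K * r + 12 \<le> card P" by (simp only: of_nat_le_iff)
  interpret sparse_configuration_model P cell part r K
  proof
    show "finite P" by (simp add: P_def)
    show "card {q \<in> P. part q = part p} = r" if "p \<in> P" for p
      using card_div_fibre[of p m r] that by (simp add: P_def part_def m)
    show "card {q \<in> P. cell q = cell p} \<le> K" if "p \<in> P" for p
    proof -
      have "cell p \<in> {1..n}" using cell(1) that by (auto simp: P_def)
      then show ?thesis using cell(2)[of "cell p"] K(2)[of "cell p"] by (simp add: P_def)
    qed
  qed (use r K sp in auto)
  have cellP: "cell ` P \<subseteq> {1..n}" "\<And>v. v \<in> {1..n} \<Longrightarrow> card {p \<in> P. cell p = v} = k v"
    using cell by (simp_all add: P_def)
  have cJ: "card (part ` P) = M n k div r"
    using div_image[of r m] r by (simp add: part_def P_def m)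
  have H: "hypergraphs r n k = {E. simple_uniform_hypergraph r {1..n} E \<and> (\<forall>v\<in>{1..n}. hdegree E v = k v)}"
    by (simp add: hypergraphs_def has_degree_sequence_def)
  have cS: "card simple_cfgs = card (hypergraphs r n k)
      * (fact (M n k div r) * fact r ^ (M n k div r) * (\<Prod>v\<in>{1..n}. fact (k v)))"
    unfolding H using card_simple_cfgs_eq[OF _ cellP] cJ by simp
  have cm: "card mates = M2 n k"
    using card_mates_eq[OF _ cellP] by (simp add: M2_def)
  note est = card_simple_cfgs[unfolded cP, OF large]
  show "card (hypergraphs r n k) > 0"
    using est(1) unfolding cS by (simp add: zero_less_mult_iff)
  have "real (card simple_cfgs) / fact (M n k) = real (card (hypergraphs r n k)) / configuration_ratio r n k"
    unfolding cS configuration_ratio_def by simp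
  then show "\<bar>ln (real (card (hypergraphs r n k)) / configuration_ratio r n k)
       + (real r - 1) * real (M2 n k) / (2 * real (M n k))\<bar> \<le> 40 * real r ^ 4 * real K ^ 3 / real (M n k)"
    using est(2) by (simp add: cm mult.commute)
qed

section \<open>Forbidden edges\<close>

text \<open>If truncation occurs at a vertex of \<open>e\<close>, that vertex has degree 0 and no
  hypergraph with degrees \<open>k\<close> contains \<open>e\<close>.\<close>

definition delete_edge_degrees :: "'a set \<Rightarrow> ('a \<Rightarrow> nat) \<Rightarrow> 'a \<Rightarrow> nat" where
  "delete_edge_degrees e k i = (if i \<in> e then k i - 1 else k i)"

text \<open>The deleted edge can be put back, so deletion is injective. It need not be onto, as a
  hypergraph with the lowered degrees may still contain \<open>e\<close>.\<close>

lemma card_hypergraphs_containing: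
  assumes e: "e \<subseteq> {1..n}" "card e = r"
  shows "card {E \<in> hypergraphs r n k. e \<in> E} \<le> card (hypergraphs r n (delete_edge_degrees e k))"
proof -
  have "inj_on (\<lambda>E. E - {e}) {E \<in> hypergraphs r n k. e \<in> E}"
    by (intro inj_onI) blast
  moreover have "(\<lambda>E. E - {e}) ` {E \<in> hypergraphs r n k. e \<in> E} \<subseteq> hypergraphs r n (delete_edge_degrees e k)"
  proof (rule image_subsetI)
    fix E assume "E \<in> {E \<in> hypergraphs r n k. e \<in> E}"
    then have E: "simple_uniform_hypergraph r {1..n} E" "\<And>i. i \<in> {1..n} \<Longrightarrow> hdegree E i = k i" "e \<in> E"
      by (auto simp: hypergraphs_def has_degree_sequence_def)
    have "finite E" by (rule finite_subset[of _ "Pow {1..n}"]) (use E(1) in \<open>auto simp: simple_uniform_hypergraph_def\<close>)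
    have "hdegree (E - {e}) i = delete_edge_degrees e k i" if "i \<in> {1..n}" for i
    proof -
      have "{f \<in> E - {e}. i \<in> f} = {f \<in> E. i \<in> f} - {e}" by auto
      then show ?thesis using E(2)[OF that] E(3) \<open>finite E\<close>
        by (simp add: hdegree_def delete_edge_degrees_def card_Diff_singleton_if)
    qed
    then show "E - {e} \<in> hypergraphs r n (delete_edge_degrees e k)"
      using E(1) by (auto simp: hypergraphs_def has_degree_sequence_def simple_uniform_hypergraph_def)
  qed
  ultimately show ?thesis by (rule card_inj_on_le) simp
qed

section \<open>Parameters of a degree sequence after deletion of an edge\<close>

context
  fixes n r :: nat and e :: "nat set"
  assumes e: "e \<subseteq> {1..n}" "card e = r"
begin

lemma sum_indicator_edge: "(\<Sum>i=1..n. if i \<in> e then c else 0) = c * r" for c :: nat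
proof -
  have "{1..n} \<inter> e = e" using e by auto
  then show ?thesis using sum.inter_restrict[of "{1..n}" "\<lambda>_. c" e] e by (simp add: mult.commute)
qed

lemma M_delete_edge:
  assumes k: "\<And>i. i \<in> e \<Longrightarrow> k i \<ge> 1"
  shows "M n (delete_edge_degrees e k) + r = M n k"
proof -
  have "M n k = (\<Sum>i=1..n. delete_edge_degrees e k i + (if i \<in> e then 1 else 0))"
    unfolding M_def by (intro sum.cong refl) (auto simp: delete_edge_degrees_def dest!: k)
  then show ?thesis using sum_indicator_edge[of 1] by (simp add: sum.distrib M_def)
qed

text \<open>Lowering a positive degree \<open>a\<close> by one lowers \<open>a * (a - 1)\<close> by
  \<open>2 * (a - 1)\<close>, and this happens at \<open>r\<close> vertices.\<close>

lemma M2_delete_edge: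
  assumes K: "\<And>i. i \<in> {1..n} \<Longrightarrow> k i \<le> K"
  shows "M2 n k \<le> M2 n (delete_edge_degrees e k) + 2 * K * r"
proof -
  have "falling a 2 \<le> falling (a - 1) 2 + 2 * K" if "a \<le> K" for a
  proof -
    consider "a = 0" | "a = 1" | b where "a = Suc (Suc b)" by (metis One_nat_def not0_implies_Suc)
    then show ?thesis
      using that by cases (auto simp: falling_def numeral_2_eq_2)
  qed
  then have "M2 n k \<le> (\<Sum>i=1..n. falling (delete_edge_degrees e k i) 2 + (if i \<in> e then 2 * K else 0))"
    unfolding M2_def using K by (intro sum_mono) (auto simp: delete_edge_degrees_def)
  then show ?thesis using sum_indicator_edge[of "2 * K"] by (simp add: sum.distrib M2_def)
qed

lemma prod_fact_delete_edge:
  assumes k: "\<And>i. i \<in> e \<Longrightarrow> k i \<ge> 1" and K: "\<And>i. i \<in> {1..n} \<Longrightarrow> k i \<le> K"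
  shows "(\<Prod>i=1..n. fact (k i) :: real) \<le> real K ^ r * (\<Prod>i=1..n. fact (delete_edge_degrees e k i))"
proof -
  have "(\<Prod>i=1..n. fact (k i) :: real) 
      \<le> (\<Prod>i=1..n. (if i \<in> e then real K else 1) * fact (delete_edge_degrees e k i))"
  proof (rule prod_mono, intro conjI)
    fix i assume i: "i \<in> {1..n}"
    show "fact (k i) \<le> (if i \<in> e then real K else 1) * fact (delete_edge_degrees e k i)"
    proof (cases "i \<in> e")
      case True
      then obtain b where b: "k i = Suc b" using k[of i] by (cases "k i") auto
      have "real (Suc b) * fact b \<le> real K * fact b" 
        using K[OF i] b by (intro mult_right_mono) auto
      then show ?thesis using True b by (simp add: delete_edge_degrees_def)
    qed (simp add: delete_edge_degrees_def)
  qed simp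
  also have "\<dots> = (\<Prod>i=1..n. if i \<in> e then real K else 1) * (\<Prod>i=1..n. fact (delete_edge_degrees e k i))"
    by (rule prod.distrib)
  also have "(\<Prod>i=1..n. if i \<in> e then real K else 1) = real K ^ r"
  proof -
    have "{1..n} \<inter> e = e" using e by auto
    then show ?thesis using prod.inter_restrict[of "{1..n}" "\<lambda>_. real K" e] e by simp
  qed
  finally show ?thesis .
qed

end

text \<open>Passing from \<open>s\<close> to \<open>s + 1\<close> multiplies the left side by
  \<open>s * K / (m - s)\<close>, which is at most 1 because \<open>m \<ge> 2 * s * K\<close>. So
  the value at \<open>s = 3\<close> dominates; there the denominator is
  \<open>(m - 1) * (m - 2)\<close>, at least \<open>m^2 / 4\<close>.\<close>

lemma falling_ratio_bound:
  assumes s: "s \<ge> 3" and K: "K \<ge> 1" and m: "m \<ge> 2 * s * K"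
  shows "fact (s - 1) * real K ^ s * fact (m - s) / fact (m - 1) \<le> 8 * real K ^ 3 / real m ^ 2"
  using s m
proof (induction s rule: dec_induct)
  case base
  have m6: "m \<ge> 6" using base K by linarith
  define b where "b = m - 3"
  have mb: "m = Suc (Suc (Suc b))" using m6 by (simp add: b_def)
  have "fact (3 - 1) * real K ^ 3 * fact (m - 3) / fact (m - 1) = 2 * real K ^ 3 / (real (b + 2) * real (b + 1))"
  proof -
    have f: "(fact (m - 1) :: real) = (real (b + 2) * real (b + 1)) * fact b"
      by (simp add: mb algebra_simps)
    show ?thesis unfolding f b_def[symmetric]
      by (subst nonzero_mult_divide_mult_cancel_right) (simp_all add: fact_numeral)
  qed
  also have "\<dots> \<le> 2 * real K ^ 3 / (real m ^ 2 / 4)"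
  proof (intro divide_left_mono)
    have "b \<ge> 3" using m6 mb by simp
    then have "real m / 2 \<le> real (b + 2)" "real m / 2 \<le> real (b + 1)" using mb by auto
    then have "real m / 2 * (real m / 2) \<le> real (b + 2) * real (b + 1)" by (intro mult_mono) auto
    then show "real m ^ 2 / 4 \<le> real (b + 2) * real (b + 1)" by (simp add: power2_eq_square)
  qed (use m6 in auto)
  finally show ?case by simp
next
  case (step s)
  have m: "2 * s * K + 2 * K \<le> m" using step.prems by (simp add: algebra_simps)
  then have sm: "s < m" and IHm: "2 * s * K \<le> m" using K mult_le_mono2[of 1 K s] by linarith+
  define b where "b = m - Suc s"
  have b: "m - s = Suc b" "m - Suc s = b" using sm by (simp_all add: b_def)
  obtain s' where s': "s = Suc s'" using step.hyps by (cases s) auto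
  have "s * K \<le> Suc b"
  proof -
    have "s \<le> s * K" using K by simp
    then have "s + s * K \<le> m" using IHm by linarith
    then show ?thesis using b(1) by linarith
  qed
  then have le1: "real (s * K) / real (Suc b) \<le> 1" by (simp del: of_nat_Suc of_nat_mult)
  have "fact (Suc s - 1) * real K ^ Suc s * fact (m - Suc s) / fact (m - 1)
    = fact (s - 1) * real K ^ s * fact (m - s) / fact (m - 1) * (real (s * K) / real (Suc b))"
    unfolding b by (simp add: s' field_simps del: of_nat_Suc) (simp add: algebra_simps)
  also have "\<dots> \<le> fact (s - 1) * real K ^ s * fact (m - s) / fact (m - 1) * 1"
    using le1 by (intro mult_left_mono) auto
  also have "\<dots> \<le> 8 * real K ^ 3 / real m ^ 2" using step.IH[OF IHm] by simp
  finally show ?case .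
qed

text \<open>With \<open>m = q * r\<close>, the factor \<open>q * r\<close> cancels from
  \<open>fact m\<close> and from \<open>fact q * fact r ^ q\<close>. The quotient of the two ratios
  is then \<open>fact (m - r) * fact (r - 1) / fact (m - 1)\<close> times a quotient of degree
  factorials, which is at most \<open>K ^ r\<close>.\<close>

lemma configuration_ratio_delete_edge:
  assumes e: "e \<subseteq> {1..n}" "card e = r" and k: "\<And>i. i \<in> e \<Longrightarrow> k i \<ge> 1" 
    and K: "K \<ge> 1" "\<And>i. i \<in> {1..n} \<Longrightarrow> k i \<le> K" and r: "r \<ge> 3" and dvd: "r dvd M n k"
    and m: "M n k \<ge> 2 * r * K"
  shows "configuration_ratio r n (delete_edge_degrees e k)
    \<le> 8 * real K ^ 3 / real (M n k) ^ 2 * configuration_ratio r n k"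
proof -
  let ?k = "delete_edge_degrees e k" and ?m = "M n k"
  let ?D = "\<Prod>i=1..n. fact (k i) :: real" and ?D' = "\<Prod>i=1..n. fact (?k i) :: real"
  obtain q where q: "?m = q * r" using dvd by (metis dvd_def mult.commute)
  have "?m > 0" using m r K by (metis gr0I mult_is_0 not_one_le_zero numeral_eq_Suc le_zero_eq nat.simps(3))
  then obtain q' where q': "q = Suc q'" using q by (cases q) auto
  have "M n ?k + r = ?m" by (rule M_delete_edge[OF e k])
  then have Mk: "M n ?k = q' * r" "?m - r = q' * r" using q q' by simp_all
  have rpos: "r > 0" using r by simp
  have D: "?D \<le> real K ^ r * ?D'" by (rule prod_fact_delete_edge[OF e k K(2)])
  have D0: "?D > 0" "?D' > 0" by (auto intro: prod_pos)
  define A where "A = (fact q' * fact r ^ q' :: real)"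
  have A0: "A > 0" by (simp add: A_def)
  have R': "configuration_ratio r n ?k = fact (?m - r) / (A * ?D')"
    using rpos by (simp add: configuration_ratio_def Mk A_def)
  have fm: "(fact ?m :: real) = real q * real r * fact (?m - 1)"
    using \<open>?m > 0\<close> q by (subst fact_reduce) simp_all
  have fr: "(fact r :: real) = real r * fact (r - 1)"
    using rpos by (subst fact_reduce) simp_all
  have R: "configuration_ratio r n k = fact (?m - 1) / (A * fact (r - 1) * ?D)"
  proof -
    have "configuration_ratio r n k = (real q * real r * fact (?m - 1)) / ((real q * fact q') * (fact r * fact r ^ q') * ?D)"
    proof -
      have md: "?m div r = Suc q'" using q q' rpos by simp
      show ?thesis unfolding configuration_ratio_def md fm q' by (simp only: fact_Suc power_Suc)
    qed
    also have "\<dots> = (real q * real r) * fact (?m - 1) / ((real q * real r) * (A * fact (r - 1) * ?D))"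
      by (simp add: fr A_def mult_ac power_mult_distrib)
    also have "\<dots> = fact (?m - 1) / (A * fact (r - 1) * ?D)"
      using rpos q' by (subst mult_divide_mult_cancel_left) auto
    finally show ?thesis .
  qed
  have "configuration_ratio r n ?k = (fact (?m - r) * fact (r - 1) / (A * fact (r - 1) * ?D)) * (?D / ?D')"
    unfolding R' using D0 A0 by (simp add: field_simps)
  also have "\<dots> \<le> (fact (?m - r) * fact (r - 1) / (A * fact (r - 1) * ?D)) * real K ^ r"
    using D D0 A0 by (intro mult_left_mono divide_nonneg_pos) (auto simp: divide_le_eq)
  also have "\<dots> = (fact (r - 1) * real K ^ r * fact (?m - r) / fact (?m - 1)) * configuration_ratio r n k"
    unfolding R by (simp add: field_simps)
  also have "\<dots> \<le> (8 * real K ^ 3 / real ?m ^ 2) * configuration_ratio r n k"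
    using falling_ratio_bound[OF r K(1) m] configuration_ratio_pos[of r n k] by (intro mult_right_mono) auto
  finally show ?thesis .
qed

section \<open>The probability of containing a given edge\<close>

lemma card_le_exp:
  assumes "real N > 0" "F > 0" "\<bar>ln (real N / F) + L\<bar> \<le> \<delta>"
  shows "real N \<le> F * exp (\<delta> - L)" "F * exp (- \<delta> - L) \<le> real N"
proof -
  have N: "real N = F * exp (ln (real N / F))" using assms by simp
  have "ln (real N / F) \<le> \<delta> - L" "- \<delta> - L \<le> ln (real N / F)"
    using assms(3) by linarith+
  then have "F * exp (ln (real N / F)) \<le> F * exp (\<delta> - L)" "F * exp (- \<delta> - L) \<le> F * exp (ln (real N / F))"
    using assms(2) by (simp_all only: mult_le_cancel_left_pos exp_le_cancel_iff)
  then show "real N \<le> F * exp (\<delta> - L)" "F * exp (- \<delta> - L) \<le> real N"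
    using N by linarith+
qed

text \<open>The counting estimate applies to \<open>k\<close> and to the lowered degrees, so the
  quotient of the leading factors decides. The exponential corrections cost at most a further factor
  2, which turns 8 into 16.\<close>

lemma card_hypergraphs_containing_le:
  assumes r: "r \<ge> 3" and dvd: "r dvd M n k" and K: "K \<ge> 1" "\<And>i. i \<in> {1..n} \<Longrightarrow> k i \<le> K"
    and large: "242 * real r ^ 4 * real K ^ 3 \<le> real (M n k)" and e: "e \<subseteq> {1..n}" "card e = r"
  shows "real (card {E \<in> hypergraphs r n k. e \<in> E})
    \<le> 16 * real K ^ 3 / real (M n k) ^ 2 * real (card (hypergraphs r n k))"
proof (cases "\<exists>i\<in>e. k i = 0")
  case True
  then obtain i where i: "i \<in> e" "k i = 0" by auto
  have "False" if E: "E \<in> hypergraphs r n k" "e \<in> E" for E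
  proof -
    have "finite E" by (rule finite_subset[of _ "Pow {1..n}"])
        (use E in \<open>auto simp: simple_uniform_hypergraph_def hypergraphs_def\<close>)
    moreover have "card {f \<in> E. i \<in> f} = 0"
      using E i e by (auto simp: hypergraphs_def has_degree_sequence_def hdegree_def)
    ultimately show False using E i by auto
  qed
  then have empty: "{E \<in> hypergraphs r n k. e \<in> E} = {}" by auto
  show ?thesis unfolding empty by simp
next
  case False
  then have k1: "k i \<ge> 1" if "i \<in> e" for i using that by (metis One_nat_def Suc_leI neq0_conv)
  let ?k = "delete_edge_degrees e k"
  define m where "m = real (M n k)"
  define m' where "m' = real (M n ?k)"
  define \<epsilon> where "\<epsilon> = real r ^ 4 * real K ^ 3 / m"
  define L where "L = (real r - 1) * real (M2 n k) / (2 * m)"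
  define L' where "L' = (real r - 1) * real (M2 n ?k) / (2 * m')"
  have rK: "real r \<ge> 3" "real K \<ge> 1" using r K by simp_all
  note sb = sparse_bounds[OF rK]
  have m0: "m > 0" using large sb by (simp add: m_def)
  \<comment> \<open>The total exponent below is at most \<open>121 * \<epsilon>\<close>; the
    constant 242 keeps it at most \<open>1 / 2\<close>.\<close>
  have \<epsilon>: "0 \<le> \<epsilon>" "\<epsilon> \<le> 1 / 242" using large m0 by (simp_all add: \<epsilon>_def field_simps m_def)
  have Mk: "M n ?k + r = M n k" by (rule M_delete_edge[OF e k1])
  then have mm: "m = m' + real r" unfolding m_def m'_def of_nat_add[symmetric] by simp
  have large': "242 * (real r ^ 4 * real K ^ 3) \<le> m" using large by (simp add: m_def)
  have half: "m / 2 \<le> m'" using mm sb large' by linarith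
  have m'0: "m' > 0" using half m0 by linarith
  have nat_large: "M n k \<ge> 2 * r * K"
  proof -
    have "2 * (real r * real K) \<le> m" using sb large' by linarith
    then have "real (2 * r * K) \<le> real (M n k)" by (simp add: m_def)
    then show ?thesis by (simp only: of_nat_le_iff)
  qed
  have dvd': "r dvd M n ?k" using dvd unfolding Mk[symmetric] by simp
  have K': "?k i \<le> K" if "i \<in> {1..n}" for i using K(2)[OF that] by (auto simp: delete_edge_degrees_def)
  have "32 * (real r ^ 4 * real K ^ 3) \<le> m'" using half large' sb by linarith
  then have "32 * real r ^ 4 * real K ^ 3 \<le> real (M n ?k)" by (simp add: m'_def)
  note est' = card_hypergraphs_estimate[OF r dvd' K(1) K' this]
  have "32 * (real r ^ 4 * real K ^ 3) \<le> m" using large' sb by linarith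
  then have "32 * real r ^ 4 * real K ^ 3 \<le> real (M n k)" by (simp add: m_def)
  note est = card_hypergraphs_estimate[OF r dvd K this]
  have "\<bar>ln (real (card (hypergraphs r n k)) / configuration_ratio r n k) + L\<bar> \<le> 40 * \<epsilon>"
    using est(2) by (simp add: \<epsilon>_def L_def m_def)
  then have lower: "configuration_ratio r n k * exp (- 40 * \<epsilon> - L) \<le> real (card (hypergraphs r n k))"
    using card_le_exp(2)[OF _ configuration_ratio_pos] est(1) by simp
  \<comment> \<open>Since \<open>m'\<close> is at least \<open>m / 2\<close>, the error at the
    lowered degrees is at most twice the original one, whence 80.\<close>
  have "40 * real r ^ 4 * real K ^ 3 / m' \<le> 40 * real r ^ 4 * real K ^ 3 / (m / 2)"
    using half m0 by (intro divide_left_mono) auto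
  then have "\<bar>ln (real (card (hypergraphs r n ?k)) / configuration_ratio r n ?k) + L'\<bar> \<le> 80 * \<epsilon>"
    using est'(2) by (simp add: \<epsilon>_def L'_def m'_def)
  then have upper: "real (card (hypergraphs r n ?k)) \<le> configuration_ratio r n ?k * exp (80 * \<epsilon> - L')"
    using card_le_exp(1)[OF _ configuration_ratio_pos] est'(1) by simp
  \<comment> \<open>Deletion lowers \<open>M2\<close> by at most \<open>2 * K * r\<close>, while the
    smaller denominator \<open>m'\<close> only increases \<open>L'\<close>.\<close>
  have LL: "L - L' \<le> \<epsilon>"
  proof -
    have "M2 n k \<le> M2 n ?k + 2 * K * r" by (rule M2_delete_edge[OF e K(2)])
    then have "real (M2 n k) \<le> real (M2 n ?k + 2 * K * r)" by (rule of_nat_mono)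
    then have "real (M2 n k) \<le> real (M2 n ?k) + 2 * real K * real r" by simp
    then have "(real r - 1) * real (M2 n k) / (2 * m) \<le> (real r - 1) * (real (M2 n ?k) + 2 * real K * real r) / (2 * m)"
      using rK m0 by (intro divide_right_mono mult_left_mono) auto
    also have "\<dots> = (real r - 1) * real (M2 n ?k) / (2 * m) + (real r - 1) * (real K * real r) / m"
      using m0 by (simp add: field_simps)
    also have "(real r - 1) * real (M2 n ?k) / (2 * m) \<le> L'"
      unfolding L'_def using rK m'0 mm by (intro divide_left_mono) auto
    also have "(real r - 1) * (real K * real r) / m \<le> real r * (real K * real r) / m"
      using rK m0 by (intro divide_right_mono mult_right_mono) auto
    also have "\<dots> \<le> \<epsilon>"
      unfolding \<epsilon>_def using sb(2) m0 by (intro divide_right_mono) (auto simp: power2_eq_square mult_ac)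
    finally show ?thesis by (simp add: L_def)
  qed
  have "real (card {E \<in> hypergraphs r n k. e \<in> E}) \<le> real (card (hypergraphs r n ?k))"
    using card_hypergraphs_containing[OF e] by simp
  also note upper
  also have "configuration_ratio r n ?k * exp (80 * \<epsilon> - L')
     \<le> (8 * real K ^ 3 / m ^ 2 * configuration_ratio r n k) * exp (80 * \<epsilon> - L')"
    unfolding m_def by (intro mult_right_mono configuration_ratio_delete_edge[OF e k1 K r dvd nat_large]) auto
  \<comment> \<open>The exponent is split so that the lower bound for the count at \<open>k\<close>
    appears as a factor; 120 is 80 plus 40.\<close>
  also have "\<dots> = 8 * real K ^ 3 / m ^ 2 * exp (120 * \<epsilon> + (L - L')) * (configuration_ratio r n k * exp (- 40 * \<epsilon> - L))"
    by (simp flip: exp_add)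
  also have "\<dots> \<le> 8 * real K ^ 3 / m ^ 2 * 2 * real (card (hypergraphs r n k))"
  proof -
    have "exp (120 * \<epsilon> + (L - L')) \<le> exp (1 / 2)" using LL \<epsilon> by simp
    also have "exp (1 / 2 :: real) \<le> 2" using exp_bound_half[of "1 / 2 :: real"] by simp
    finally show ?thesis using lower configuration_ratio_pos[of r n k] by (intro mult_mono) auto
  qed
  finally show ?thesis by (simp add: m_def)
qed

lemma card_hypergraphs_meeting_le:
  assumes r: "r \<ge> 3" and dvd: "r dvd M n k" and K: "K \<ge> 1" "\<And>i. i \<in> {1..n} \<Longrightarrow> k i \<le> K"
    and large: "242 * real r ^ 4 * real K ^ 3 \<le> real (M n k)" 
    and X: "simple_uniform_hypergraph r {1..n} X"
  shows "real (card (hypergraphs r n k)) - real (card (hypergraphs_avoiding r n k X))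
    \<le> 16 * (real (card X) * real K ^ 3 / real (M n k) ^ 2) * real (card (hypergraphs r n k))"
proof -
  have finX: "finite X" 
    by (rule finite_subset[of _ "Pow {1..n}"]) (use X in \<open>auto simp: simple_uniform_hypergraph_def\<close>)
  have "hypergraphs r n k \<subseteq> hypergraphs_avoiding r n k X \<union> (\<Union>e\<in>X. {E \<in> hypergraphs r n k. e \<in> E})"
    by (auto simp: hypergraphs_avoiding_def)
  moreover have "finite (hypergraphs_avoiding r n k X)"
    by (rule finite_subset[OF _ finite_hypergraphs[of r n k]]) (auto simp: hypergraphs_avoiding_def)
  ultimately have "card (hypergraphs r n k) 
      \<le> card (hypergraphs_avoiding r n k X \<union> (\<Union>e\<in>X. {E \<in> hypergraphs r n k. e \<in> E}))"
    using finX by (intro card_mono) auto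
  also have "\<dots> \<le> card (hypergraphs_avoiding r n k X) + (\<Sum>e\<in>X. card {E \<in> hypergraphs r n k. e \<in> E})"
    by (rule order.trans[OF card_Un_le add_left_mono[OF card_UN_le[OF finX]]])
  finally have "real (card (hypergraphs r n k)) 
     \<le> real (card (hypergraphs_avoiding r n k X) + (\<Sum>e\<in>X. card {E \<in> hypergraphs r n k. e \<in> E}))"
    by (rule of_nat_mono)
  moreover have "real (\<Sum>e\<in>X. card {E \<in> hypergraphs r n k. e \<in> E})
      \<le> (\<Sum>e\<in>X. 16 * real K ^ 3 / real (M n k) ^ 2 * real (card (hypergraphs r n k)))"
    unfolding of_nat_sum using X
    by (intro sum_mono card_hypergraphs_containing_le[OF r dvd K large])
      (auto simp: simple_uniform_hypergraph_def)
  ultimately show ?thesis by (simp add: mult_ac)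
qed

text \<open>Covers \<open>M n k = 0\<close>, which the asymptotic hypotheses allow: the maximum
  degree is then 0 and both conditions hold trivially.\<close>

lemma hypergraphs_zero_degrees:
  assumes "r \<ge> 1" "\<And>i. i \<in> {1..n} \<Longrightarrow> k i = 0"
  shows "hypergraphs r n k = {{}}"
proof (intro equalityI subsetI)
  fix E assume E: "E \<in> hypergraphs r n k"
  then have finE: "finite E" 
    by (intro finite_subset[of E "Pow {1..n}"]) (auto simp: simple_uniform_hypergraph_def hypergraphs_def)
  have "False" if e: "e \<in> E" for e
  proof -
    have "e \<subseteq> {1..n}" "card e = r" using E e by (auto simp: hypergraphs_def simple_uniform_hypergraph_def)
    then obtain i where i: "i \<in> e" "i \<in> {1..n}" using assms(1) by (metis card.empty ex_in_conv not_one_le_zero subsetD)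
    have "hdegree E i = 0" using E i assms(2) by (simp add: hypergraphs_def has_degree_sequence_def)
    then show False using finE e i by (auto simp: hdegree_def)
  qed
  then show "E \<in> {{}}" by auto
qed (use assms in \<open>auto simp: hypergraphs_def has_degree_sequence_def simple_uniform_hypergraph_def hdegree_def\<close>)

section \<open>Explicit estimates for hypergraphs avoiding \<open>X\<close>, and their asymptotic
  form\<close>

lemma le_kmax: "i \<in> {1..n} \<Longrightarrow> k i \<le> kmax n k"
  unfolding kmax_def by (intro Max_ge) auto

text \<open>The proportion of hypergraphs meeting \<open>X\<close> is at most 16 times
  \<open>rho\<close>, and \<open>1 / 32\<close> brings this below \<open>1 / 2\<close>, where its
  logarithmic effect is at most \<open>32 * rho\<close>. The last bound adds this to the error of
  the unrestricted count.\<close>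

lemma hypergraphs_avoiding_estimate:
  assumes n: "n \<ge> 1" and r: "r \<ge> 3" and dvd: "r dvd M n k" and X: "simple_uniform_hypergraph r {1..n} X"
    and large: "242 * (real r ^ 4 * real (kmax n k) ^ 3) \<le> real (M n k)" 
    and rho: "rho r n k (card X) \<le> 1 / 32"
  shows "card (hypergraphs r n k) > 0" "card (hypergraphs_avoiding r n k X) > 0"
    "\<bar>ln (real (card (hypergraphs_avoiding r n k X)) / real (card (hypergraphs r n k)))\<bar> \<le> 32 * rho r n k (card X)"
    "\<bar>ln (real (card (hypergraphs_avoiding r n k X)) / configuration_ratio r n k)
       + (real r - 1) * real (M2 n k) / (2 * real (M n k))\<bar>
     \<le> 40 * (real r ^ 4 * real (kmax n k) ^ 3 / real (M n k) + rho r n k (card X))"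
proof -
  let ?H = "real (card (hypergraphs r n k))" and ?A = "real (card (hypergraphs_avoiding r n k X))"
  let ?K = "kmax n k" and ?\<rho> = "rho r n k (card X)" and ?F = "configuration_ratio r n k"
  define L where "L = (real r - 1) * real (M2 n k) / (2 * real (M n k))"
  define \<epsilon> where "\<epsilon> = real r ^ 4 * real ?K ^ 3 / real (M n k)"
  have \<rho>0: "?\<rho> \<ge> 0" by (simp add: rho_def)
  have \<epsilon>0: "\<epsilon> \<ge> 0" by (simp add: \<epsilon>_def)
  have "?H > 0 \<and> ?A > 0 \<and> \<bar>ln (?A / ?H)\<bar> \<le> 32 * ?\<rho> \<and> \<bar>ln (?H / ?F) + L\<bar> \<le> 40 * \<epsilon>"
  proof (cases "M n k = 0")
    \<comment> \<open>Only the empty hypergraph remains. Division by \<open>M n k = 0\<close> yields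
      0, so \<open>L\<close> and \<open>\<epsilon>\<close> vanish.\<close>
    case True
    then have k0: "k i = 0" if "i \<in> {1..n}" for i using that by (auto simp: M_def)
    have H: "hypergraphs r n k = {{}}" using hypergraphs_zero_degrees[of r n k] r k0 by simp
    then have "hypergraphs_avoiding r n k X = {{}}" by (auto simp: hypergraphs_avoiding_def)
    moreover have "configuration_ratio r n k = 1" using k0 True by (simp add: configuration_ratio_def)
    ultimately show ?thesis using H True \<rho>0 \<epsilon>0 by (simp add: L_def)
  next
    case False
    have K: "?K \<ge> 1"
    proof (rule ccontr)
      assume "\<not> ?K \<ge> 1"
      then have "k i = 0" if "i \<in> {1..n}" for i using le_kmax[OF that, of k] by simp
      then show False using False by (simp add: M_def)
    qed
    have "32 * (real r ^ 4 * real ?K ^ 3) \<le> 242 * (real r ^ 4 * real ?K ^ 3)" by (intro mult_right_mono) auto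
    then have "32 * real r ^ 4 * real ?K ^ 3 \<le> real (M n k)" using large by simp
    note est = card_hypergraphs_estimate[OF r dvd K le_kmax this]
    have "242 * real r ^ 4 * real ?K ^ 3 \<le> real (M n k)" using large by simp
    note meet = card_hypergraphs_meeting_le[OF r dvd K le_kmax this X]
    have H0: "?H > 0" using est(1) by (simp only: of_nat_0_less_iff)
    have "real (card X) * real ?K ^ 3 / real (M n k) ^ 2 \<le> ?\<rho>" by (simp add: rho_def)
    then have "16 * (real (card X) * real ?K ^ 3 / real (M n k) ^ 2) * ?H \<le> 16 * ?\<rho> * ?H"
      by (intro mult_right_mono mult_left_mono) auto
    with meet have d: "?H - ?A \<le> 16 * ?\<rho> * ?H" by linarith
    have AH: "?A \<le> ?H" by (intro of_nat_mono card_mono) (auto simp: hypergraphs_avoiding_def)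
    define y where "y = (?H - ?A) / ?H"
    have y: "0 \<le> y" "y \<le> 16 * ?\<rho>" using d AH H0 by (simp_all add: y_def divide_le_eq)
    have AHy: "?A / ?H = 1 - y" unfolding y_def diff_divide_distrib using H0 by (subst divide_self) linarith+
    have "16 * ?\<rho> \<le> 1 / 2" using rho by simp
    note ln_one_minus_small[OF y this, folded AHy]
    moreover have "?A / ?H > 0" using AHy y rho by linarith
    then have "?A > 0" using H0 by (simp add: zero_less_divide_iff)
    moreover have "\<bar>ln (?H / ?F) + L\<bar> \<le> 40 * \<epsilon>" using est(2) by (simp add: L_def \<epsilon>_def mult.assoc)
    ultimately show ?thesis using H0 by auto
  qed
  then have H0: "?H > 0" and A0: "?A > 0" and AH: "\<bar>ln (?A / ?H)\<bar> \<le> 32 * ?\<rho>" and HF: "\<bar>ln (?H / ?F) + L\<bar> \<le> 40 * \<epsilon>"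
    by blast+
  show "card (hypergraphs r n k) > 0" "card (hypergraphs_avoiding r n k X) > 0"
    using H0 A0 by (simp_all only: of_nat_0_less_iff)
  show "\<bar>ln (?A / ?H)\<bar> \<le> 32 * ?\<rho>" by (rule AH)
  have F0: "?F > 0" by (rule configuration_ratio_pos)
  have "ln (?A / ?F) = ln (?A / ?H) + ln (?H / ?F)"
    unfolding ln_divide_pos[OF A0 F0] ln_divide_pos[OF A0 H0] ln_divide_pos[OF H0 F0] by simp
  then have "ln (?A / ?F) + L = ln (?A / ?H) + (ln (?H / ?F) + L)" by simp
  then have "\<bar>ln (?A / ?F) + L\<bar> \<le> 32 * ?\<rho> + 40 * \<epsilon>"
    using abs_triangle_ineq[of "ln (?A / ?H)" "ln (?H / ?F) + L"] AH HF by linarith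
  also have "\<dots> \<le> 40 * (\<epsilon> + ?\<rho>)" using \<rho>0 by simp
  finally show "\<bar>ln (?A / ?F) + (real r - 1) * real (M2 n k) / (2 * real (M n k))\<bar>
     \<le> 40 * (real r ^ 4 * real (kmax n k) ^ 3 / real (M n k) + ?\<rho>)"
    by (simp only: L_def \<epsilon>_def)
qed

theorem theorem1p1:
  fixes r :: "nat \<Rightarrow> nat"
    and k :: "nat \<Rightarrow> nat \<Rightarrow> nat"
    and X :: "nat \<Rightarrow> nat set set"
    and x :: "nat \<Rightarrow> nat \<Rightarrow> nat"
    and t :: "nat \<Rightarrow> nat"
  assumes "\<And>n. n \<ge> 3 \<Longrightarrow> r n \<ge> 3"
    and "infinite (admissible r k)"
    and "\<And>n. n \<ge> 3 \<Longrightarrow> simple_uniform_hypergraph (r n) {1..n} (X n)"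
    and "\<And>n. n \<ge> 3 \<Longrightarrow> has_degree_sequence n (X n) (x n)"
    and "\<And>n. n \<ge> 3 \<Longrightarrow> card (X n) = t n"
    and "(\<lambda>n. real (r n) ^ 4 * real (kmax n (k n)) ^ 3)
           \<in> o[along (admissible r k)](\<lambda>n. real (M n (k n)))"
    and "(\<lambda>n. rho (r n) n (k n) (t n)) \<in> o[along (admissible r k)](\<lambda>_. 1)"
  shows "(\<exists>g :: nat \<Rightarrow> real.
            g \<in> O[along (admissible r k)](\<lambda>n. rho (r n) n (k n) (t n)) \<and>
            (\<forall>\<^sub>F n in along (admissible r k).
               measure_pmf.prob (pmf_of_set (hypergraphs (r n) n (k n))) {E. E \<inter> X n = {}}
                 = exp (g n)))
       \<and> (\<exists>h :: nat \<Rightarrow> real.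
            h \<in> O[along (admissible r k)](\<lambda>n. real (r n) ^ 4 * real (kmax n (k n)) ^ 3 / real (M n (k n))
                        + rho (r n) n (k n) (t n)) \<and>
            (\<forall>\<^sub>F n in along (admissible r k).
               real (card (hypergraphs_avoiding (r n) n (k n) (X n)))
                 = fact (M n (k n))
                     / (fact (M n (k n) div r n) * fact (r n) ^ (M n (k n) div r n)
                          * (\<Prod>i=1..n. fact (k n i)))
                   * exp (- ((real (r n) - 1) * real (M2 n (k n))) / (2 * real (M n (k n)))
                          + h n)))"
proof -
  let ?N = "along (admissible r k)"
  let ?\<rho> = "\<lambda>n. rho (r n) n (k n) (t n)"
  let ?H = "\<lambda>n. real (card (hypergraphs (r n) n (k n)))"
  let ?A = "\<lambda>n. real (card (hypergraphs_avoiding (r n) n (k n) (X n)))"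
  let ?\<epsilon> = "\<lambda>n. real (r n) ^ 4 * real (kmax n (k n)) ^ 3 / real (M n (k n))"
  define L where "L n = ((real (r n) - 1) * real (M2 n (k n))) / (2 * real (M n (k n)))" for n
  \<comment> \<open>\<open>g\<close> and \<open>h\<close> are defined as logarithms, so both
    equations hold as soon as the counts are positive; what remains is to bound them. The little-o
    conditions are used with the constants \<open>1 / 242\<close> and \<open>1 / 32\<close>.\<close>
  define g where "g n = ln (?A n / ?H n)" for n
  define h where "h n = ln (?A n / configuration_ratio (r n) n (k n)) + L n" for n
  have "\<forall>\<^sub>F n in ?N. n \<in> admissible r k"
    unfolding along_def by (simp add: eventually_inf_principal)
  moreover have "\<forall>\<^sub>F n in ?N. norm (real (r n) ^ 4 * real (kmax n (k n)) ^ 3) \<le> 1 / 242 * norm (real (M n (k n)))"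
    by (rule landau_o.smallD[OF assms(6)]) simp
  moreover have "\<forall>\<^sub>F n in ?N. norm (?\<rho> n) \<le> 1 / 32 * norm (1 :: real)"
    by (rule landau_o.smallD[OF assms(7)]) simp
  ultimately have est: "\<forall>\<^sub>F n in ?N. ?H n > 0 \<and> ?A n > 0 \<and> \<bar>g n\<bar> \<le> 32 * ?\<rho> n \<and> \<bar>h n\<bar> \<le> 40 * (?\<epsilon> n + ?\<rho> n)"
  proof eventually_elim
    case (elim n)
    have n: "n \<ge> 1" "n \<ge> 3" "r n dvd M n (k n)" using elim(1) by (auto simp: admissible_def)
    have large: "242 * (real (r n) ^ 4 * real (kmax n (k n)) ^ 3) \<le> real (M n (k n))" using elim(2) by simp
    have small: "rho (r n) n (k n) (card (X n)) \<le> 1 / 32" using elim(3) assms(5)[OF n(2)] by simp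
    note * = hypergraphs_avoiding_estimate[OF n(1) assms(1)[OF n(2)] n(3) assms(3)[OF n(2)] large small]
    show ?case
      using * unfolding assms(5)[OF n(2)] g_def h_def L_def of_nat_0_less_iff by blast
  qed
  have "g \<in> O[?N](?\<rho>)"
  proof (rule bigoI[of _ 32], use est in eventually_elim)
    case (elim n)
    have "32 * ?\<rho> n \<le> 32 * \<bar>?\<rho> n\<bar>" by simp
    then show ?case using elim by simp
  qed
  moreover have "\<forall>\<^sub>F n in ?N. measure_pmf.prob (pmf_of_set (hypergraphs (r n) n (k n))) {E. E \<inter> X n = {}} = exp (g n)"
    using est
  proof eventually_elim
    case (elim n)
    have "hypergraphs (r n) n (k n) \<noteq> {}" using elim by auto
    moreover have "hypergraphs (r n) n (k n) \<inter> {E. E \<inter> X n = {}} = hypergraphs_avoiding (r n) n (k n) (X n)"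
      by (auto simp: hypergraphs_avoiding_def)
    ultimately show ?case using elim by (simp add: measure_pmf_of_set g_def)
  qed
  moreover have "h \<in> O[?N](\<lambda>n. ?\<epsilon> n + ?\<rho> n)"
  proof (rule bigoI[of _ 40], use est in eventually_elim)
    case (elim n)
    have "40 * (?\<epsilon> n + ?\<rho> n) \<le> 40 * \<bar>?\<epsilon> n + ?\<rho> n\<bar>" by (intro mult_left_mono abs_ge_self) simp
    then show ?case unfolding real_norm_def using elim by linarith
  qed
  moreover have "\<forall>\<^sub>F n in ?N. ?A n = configuration_ratio (r n) n (k n) * exp (- L n + h n)"
    using est
  proof eventually_elim
    case (elim n)
    have "configuration_ratio (r n) n (k n) > 0" by (rule configuration_ratio_pos)
    then show ?case using elim by (simp add: h_def)
  qed
  ultimately show ?thesis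
    unfolding configuration_ratio_def L_def minus_divide_left by blast
qed

end
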